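(* Let $(M,\mathfrak g)$ be an $(n+1)$-dimensional Riemannian (resp. Lorentzian) manifold, $n\ge1$, and let $\gamma:[0,T]\to M$ be a (non-constant) closed geodesic (resp. a timelike closed geodesic). Assume that the Morse indices of all iterates vanish: $$\mathrm n_-\big(\gamma^{(m)}\big)=0\qquad\text{for every integer }m\ge1.$$ Then $\gamma$ is not strongly stable.
   Context: **Setting.** $\nabla$ is the Levi-Civita connection, $\mathcal R(X,Y)=[\nabla_X,\nabla_Y]-\nabla_{[X,Y]}$. Lorentzian means that $\mathfrak g$ has exactly one negative direction. A closed geodesic is a smooth $\gamma:[0,T]\to M$ with $\frac{D}{dt}\dot\gamma=0$, $\gamma(0)=\gamma(T)$, $\dot\gamma(0)=\dot\gamma(T)$; timelike means $\mathfrak g(\dot\gamma,\dot\gamma)<0$. In both cases $\mathfrak g$ is positive definite on the $\mathfrak g$-orthogonal complement of $\dot\gamma$. Let $e_1,\dots,e_n$ be a parallel $\mathfrak g$-orthonormal frame of this complement along $\gamma$, let $A=[a_{ij}]\in \mathrm O(n)$ be defined by $e_j(T)=\sum_ia_{ij}e_i(0)$ (so $\xi=\sum u_ie_i$ satisfies $\xi(0)=\xi(T)$ iff $u(0)=Au(T)$), and let $\widehat R_{ij}(t)=\mathfrak g(\mathcal R(\dot\gamma,e_i)\dot\gamma,e_j)$, a symmetric matrix. **Morse index.** $\mathrm n_-(\gamma)$ is the maximal dimension of a subspace of $E=\{u\in W^{1,2}([0,T],\mathbf R^n):u(0)=Au(T)\}$ on which $I(u,v)=\int_0^T\big(\langle\dot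 u,\dot v\rangle+\langle\widehat R(t)u,v\rangle\big)dt$ is negative definite. The iterate $\gamma^{(m)}:[0,mT]\to M$ is $\gamma^{(m)}(t)=\gamma(t-jT)$ for $jT\le t\le(j+1)T$, $0\le j\le m-1$, and $\mathrm n_-(\gamma^{(m)})$ is its Morse index as a closed geodesic on $[0,mT]$ (with matrix $A^m$ in place of $A$). **Strong stability.** Let $\Psi(t)$ be the fundamental solution ($\Psi(0)=I$) of $\dot z=\begin{bmatrix}0&\widehat R(t)\\ I&0\end{bmatrix}z$ and let the monodromy matrix be $\mathcal P(T)=A_d\Psi(T)\in\mathrm{Sp}(2n,\mathbf R)$, where $A_d=\begin{bmatrix}A^{-\mathsf T}&0\\0&A\end{bmatrix}$ (symplectic means preserving $J=\begin{bmatrix}0&-I\\ I&0\end{bmatrix}$). A symplectic matrix is linearly stable if it is semisimple (diagonalizable over $\mathbf C$) with all eigenvalues on the unit circle. $\gamma$ is strongly stable if there is $\varepsilon>0$ such that every $S\in\mathrm{Sp}(2n,\mathbf R)$ with $\|S-\mathcal P(T)\|\le\varepsilon$ is linearly stable. *)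

theory Defs
  imports "HOL-Analysis.Analysis"
begin

subsection \<open>Smooth maps and manifolds\<close>

text \<open>Smoothness is used for open sets of a Euclidean space and for relatively open subsets of a
  nondegenerate compact interval (with one-sided derivatives at the end points). On sets of both
  kinds the derivative within the set is unique.\<close>

primrec Ck_on :: "nat \<Rightarrow> 'a::euclidean_space set \<Rightarrow> ('a \<Rightarrow> 'b::real_normed_vector) \<Rightarrow> bool" where
  "Ck_on 0 S f \<longleftrightarrow> continuous_on S f"
| "Ck_on (Suc k) S f \<longleftrightarrow>
     f differentiable_on S \<and> (\<forall>v. Ck_on k S (\<lambda>x. frechet_derivative f (at x within S) v))"

definition smooth_on :: "'a::euclidean_space set \<Rightarrow> ('a \<Rightarrow> 'b::real_normed_vector) \<Rightarrow> bool" where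
  "smooth_on S f \<longleftrightarrow> (\<forall>k. Ck_on k S f)"

text \<open>A chart is a pair of a domain and a coordinate map; only the values of the coordinate map on
  the domain matter.\<close>

type_synonym ('m, 'd) chart = "'m set \<times> ('m \<Rightarrow> real ^ 'd)"

definition transition :: "('m, 'd::finite) chart \<Rightarrow> ('m, 'd) chart \<Rightarrow> real ^ 'd \<Rightarrow> real ^ 'd" where
  "transition c c' = snd c' \<circ> inv_into (fst c) (snd c)"

definition is_chart :: "'m topology \<Rightarrow> ('m, 'd::finite) chart \<Rightarrow> bool" where
  "is_chart X c \<longleftrightarrow> openin X (fst c) \<and> open (snd c ` fst c) \<and>
     homeomorphic_map (subtopology X (fst c)) (top_of_set (snd c ` fst c)) (snd c)"

definition smooth_manifold :: "'m topology \<Rightarrow> ('m, 'd::finite) chart set \<Rightarrow> bool" where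
  "smooth_manifold X \<A> \<longleftrightarrow>
     Hausdorff_space X \<and> second_countable X \<and>
     (\<forall>c\<in>\<A>. is_chart X c) \<and> \<Union>(fst ` \<A>) = topspace X \<and>
     (\<forall>c\<in>\<A>. \<forall>c'\<in>\<A>. smooth_on (snd c ` (fst c \<inter> fst c')) (transition c c'))"

text \<open>A chart of the atlas around \<open>p\<close>. It is only used to evaluate expressions that do not depend
  on the choice of the chart.\<close>

definition chart_at :: "('m, 'd::finite) chart set \<Rightarrow> 'm \<Rightarrow> ('m, 'd) chart" where
  "chart_at \<A> p = (SOME c. c \<in> \<A> \<and> p \<in> fst c)"

text \<open>A tangent vector at \<open>p\<close> is given by its components in all charts around \<open>p\<close>, which are related
  by the derivatives of the transition maps.\<close>

type_synonym ('m, 'd) tvec = "('m, 'd) chart \<Rightarrow> real ^ 'd"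

definition tangent_space :: "('m, 'd::finite) chart set \<Rightarrow> 'm \<Rightarrow> ('m, 'd) tvec set" where
  "tangent_space \<A> p =
     {v. \<forall>c\<in>\<A>. \<forall>c'\<in>\<A>. p \<in> fst c \<inter> fst c' \<longrightarrow>
           v c' = frechet_derivative (transition c c') (at (snd c p)) (v c)}"

subsection \<open>Riemannian and Lorentzian metrics\<close>

text \<open>A metric is given by its Gram matrices \<open>g c x\<close> in the coordinates \<open>x\<close> of every chart \<open>c\<close>.\<close>

type_synonym ('m, 'd) metric = "('m, 'd) chart \<Rightarrow> real ^ 'd \<Rightarrow> real ^ 'd ^ 'd"

definition symmetric_tensor_field :: "('m, 'd::finite) chart set \<Rightarrow> ('m, 'd) metric \<Rightarrow> bool" where
  "symmetric_tensor_field \<A> g \<longleftrightarrow>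
     (\<forall>c\<in>\<A>. smooth_on (snd c ` fst c) (g c) \<and>
        (\<forall>x\<in>snd c ` fst c. transpose (g c x) = g c x)) \<and>
     (\<forall>c\<in>\<A>. \<forall>c'\<in>\<A>. \<forall>p\<in>fst c \<inter> fst c'. \<forall>v w.
        v \<bullet> (g c (snd c p) *v w) =
        frechet_derivative (transition c c') (at (snd c p)) v \<bullet>
          (g c' (snd c' p) *v frechet_derivative (transition c c') (at (snd c p)) w))"

definition positive_definite :: "real ^ 'd::finite ^ 'd \<Rightarrow> bool" where
  "positive_definite G \<longleftrightarrow> (\<forall>v. v \<noteq> 0 \<longrightarrow> v \<bullet> (G *v v) > 0)"

definition lorentz_signature :: "real ^ 'd::finite ^ 'd \<Rightarrow> bool" where
  "lorentz_signature G \<longleftrightarrow>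
     (\<exists>(P :: real ^ 'd ^ 'd) k. invertible P \<and>
        transpose P ** G ** P = (\<chi> i j. if i = j then (if i = k then -1 else 1) else 0))"

definition riemannian_manifold ::
    "'m topology \<Rightarrow> ('m, 'd::finite) chart set \<Rightarrow> ('m, 'd) metric \<Rightarrow> bool" where
  "riemannian_manifold X \<A> g \<longleftrightarrow> smooth_manifold X \<A> \<and> symmetric_tensor_field \<A> g \<and>
     (\<forall>c\<in>\<A>. \<forall>x\<in>snd c ` fst c. positive_definite (g c x))"

definition lorentzian_manifold ::
    "'m topology \<Rightarrow> ('m, 'd::finite) chart set \<Rightarrow> ('m, 'd) metric \<Rightarrow> bool" where
  "lorentzian_manifold X \<A> g \<longleftrightarrow> smooth_manifold X \<A> \<and> symmetric_tensor_field \<A> g \<and>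
     (\<forall>c\<in>\<A>. \<forall>x\<in>snd c ` fst c. lorentz_signature (g c x))"

definition metric_at ::
    "('m, 'd::finite) chart set \<Rightarrow> ('m, 'd) metric \<Rightarrow> 'm \<Rightarrow> ('m, 'd) tvec \<Rightarrow> ('m, 'd) tvec \<Rightarrow> real" where
  "metric_at \<A> g p v w = (let c = chart_at \<A> p in v c \<bullet> (g c (snd c p) *v w c))"

subsection \<open>Levi-Civita connection and curvature in a chart\<close>

definition partial :: "'d \<Rightarrow> (real ^ 'd::finite \<Rightarrow> real) \<Rightarrow> real ^ 'd \<Rightarrow> real" where
  "partial i f x = frechet_derivative f (at x) (axis i 1)"

text \<open>The Christoffel symbol with upper index \<open>k\<close> and lower indices \<open>i\<close>, \<open>j\<close> of the Levi-Civita
  connection of the metric with Gram matrix \<open>G\<close>.\<close>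

definition christoffel :: "(real ^ 'd \<Rightarrow> real ^ 'd ^ 'd) \<Rightarrow>
    real ^ 'd::finite \<Rightarrow> 'd \<Rightarrow> 'd \<Rightarrow> 'd \<Rightarrow> real" where
  "christoffel G x k i j =
     (\<Sum>l\<in>UNIV. matrix_inv (G x) $ k $ l *
        (partial i (\<lambda>y. G y $ j $ l) x + partial j (\<lambda>y. G y $ i $ l) x
          - partial l (\<lambda>y. G y $ i $ j) x)) / 2"

definition connection_form ::
    "(real ^ 'd \<Rightarrow> real ^ 'd ^ 'd) \<Rightarrow> real ^ 'd::finite \<Rightarrow> real ^ 'd \<Rightarrow> real ^ 'd \<Rightarrow> real ^ 'd" where
  "connection_form G x v w =
     (\<chi> k. \<Sum>i\<in>UNIV. \<Sum>j\<in>UNIV. christoffel G x k i j * v $ i * w $ j)"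

definition nabla :: "(real ^ 'd \<Rightarrow> real ^ 'd ^ 'd) \<Rightarrow> (real ^ 'd \<Rightarrow> real ^ 'd) \<Rightarrow>
    (real ^ 'd \<Rightarrow> real ^ 'd) \<Rightarrow> real ^ 'd::finite \<Rightarrow> real ^ 'd" where
  "nabla G V W x = frechet_derivative W (at x) (V x) + connection_form G x (V x) (W x)"

definition lie_bracket :: "(real ^ 'd \<Rightarrow> real ^ 'd) \<Rightarrow> (real ^ 'd \<Rightarrow> real ^ 'd) \<Rightarrow>
    real ^ 'd::finite \<Rightarrow> real ^ 'd" where
  "lie_bracket V W x = frechet_derivative W (at x) (V x) - frechet_derivative V (at x) (W x)"

definition curvature_operator :: "(real ^ 'd \<Rightarrow> real ^ 'd ^ 'd) \<Rightarrow> (real ^ 'd \<Rightarrow> real ^ 'd) \<Rightarrow>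
    (real ^ 'd \<Rightarrow> real ^ 'd) \<Rightarrow> (real ^ 'd \<Rightarrow> real ^ 'd) \<Rightarrow> real ^ 'd::finite \<Rightarrow> real ^ 'd" where
  "curvature_operator G V W Z x =
     nabla G V (nabla G W Z) x - nabla G W (nabla G V Z) x - nabla G (lie_bracket V W) Z x"

text \<open>The value at \<open>x\<close> depends only on the values of the three fields at \<open>x\<close>, so they may be extended
  by constant coordinates.\<close>

definition curvature_tensor :: "(real ^ 'd \<Rightarrow> real ^ 'd ^ 'd) \<Rightarrow> real ^ 'd::finite \<Rightarrow>
    real ^ 'd \<Rightarrow> real ^ 'd \<Rightarrow> real ^ 'd \<Rightarrow> real ^ 'd" where
  "curvature_tensor G x v w z = curvature_operator G (\<lambda>_. v) (\<lambda>_. w) (\<lambda>_. z) x"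

definition curvature_at :: "('m, 'd::finite) chart set \<Rightarrow> ('m, 'd) metric \<Rightarrow> 'm \<Rightarrow>
    ('m, 'd) tvec \<Rightarrow> ('m, 'd) tvec \<Rightarrow> ('m, 'd) tvec \<Rightarrow> ('m, 'd) tvec \<Rightarrow> real" where
  "curvature_at \<A> g p v w z z' =
     (let c = chart_at \<A> p in
        curvature_tensor (g c) (snd c p) (v c) (w c) (z c) \<bullet> (g c (snd c p) *v z' c))"

subsection \<open>Closed geodesics and parallel frames\<close>

text \<open>Curves have the parameter interval \<open>{0..T}\<close>; their values elsewhere are irrelevant.\<close>

definition chart_times :: "real \<Rightarrow> (real \<Rightarrow> 'm) \<Rightarrow> ('m, 'd) chart \<Rightarrow> real set" where
  "chart_times T \<gamma> c = {t \<in> {0..T}. \<gamma> t \<in> fst c}"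

definition smooth_curve ::
    "'m topology \<Rightarrow> ('m, 'd::finite) chart set \<Rightarrow> real \<Rightarrow> (real \<Rightarrow> 'm) \<Rightarrow> bool" where
  "smooth_curve X \<A> T \<gamma> \<longleftrightarrow> continuous_map (top_of_set {0..T}) X \<gamma> \<and>
     (\<forall>c\<in>\<A>. smooth_on (chart_times T \<gamma> c) (snd c \<circ> \<gamma>))"

definition velocity :: "real \<Rightarrow> (real \<Rightarrow> 'm) \<Rightarrow> real \<Rightarrow> ('m, 'd::finite) tvec" where
  "velocity T \<gamma> t = (\<lambda>c. vector_derivative (snd c \<circ> \<gamma>) (at t within chart_times T \<gamma> c))"

definition smooth_field_along :: "('m, 'd::finite) chart set \<Rightarrow> real \<Rightarrow> (real \<Rightarrow> 'm) \<Rightarrow>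
    (real \<Rightarrow> ('m, 'd) tvec) \<Rightarrow> bool" where
  "smooth_field_along \<A> T \<gamma> \<xi> \<longleftrightarrow> (\<forall>t\<in>{0..T}. \<xi> t \<in> tangent_space \<A> (\<gamma> t)) \<and>
     (\<forall>c\<in>\<A>. smooth_on (chart_times T \<gamma> c) (\<lambda>t. \<xi> t c))"

definition covariant_deriv_along :: "('m, 'd::finite) metric \<Rightarrow> real \<Rightarrow> (real \<Rightarrow> 'm) \<Rightarrow>
    (real \<Rightarrow> ('m, 'd) tvec) \<Rightarrow> real \<Rightarrow> ('m, 'd) tvec" where
  "covariant_deriv_along g T \<gamma> \<xi> t =
     (\<lambda>c. vector_derivative (\<lambda>s. \<xi> s c) (at t within chart_times T \<gamma> c) +
          connection_form (g c) (snd c (\<gamma> t)) (velocity T \<gamma> t c) (\<xi> t c))"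

definition parallel_along :: "('m, 'd::finite) chart set \<Rightarrow> ('m, 'd) metric \<Rightarrow> real \<Rightarrow>
    (real \<Rightarrow> 'm) \<Rightarrow> (real \<Rightarrow> ('m, 'd) tvec) \<Rightarrow> bool" where
  "parallel_along \<A> g T \<gamma> \<xi> \<longleftrightarrow>
     (\<forall>c\<in>\<A>. \<forall>t\<in>chart_times T \<gamma> c. covariant_deriv_along g T \<gamma> \<xi> t c = 0)"

definition closed_geodesic :: "'m topology \<Rightarrow> ('m, 'd::finite) chart set \<Rightarrow> ('m, 'd) metric \<Rightarrow>
    real \<Rightarrow> (real \<Rightarrow> 'm) \<Rightarrow> bool" where
  "closed_geodesic X \<A> g T \<gamma> \<longleftrightarrow> T > 0 \<and> smooth_curve X \<A> T \<gamma> \<and>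
     parallel_along \<A> g T \<gamma> (velocity T \<gamma>) \<and>
     \<gamma> 0 = \<gamma> T \<and> (\<forall>c\<in>\<A>. \<gamma> 0 \<in> fst c \<longrightarrow> velocity T \<gamma> 0 c = velocity T \<gamma> T c)"

definition timelike :: "('m, 'd::finite) chart set \<Rightarrow> ('m, 'd) metric \<Rightarrow> real \<Rightarrow>
    (real \<Rightarrow> 'm) \<Rightarrow> bool" where
  "timelike \<A> g T \<gamma> \<longleftrightarrow>
     (\<forall>t\<in>{0..T}. metric_at \<A> g (\<gamma> t) (velocity T \<gamma> t) (velocity T \<gamma> t) < 0)"

text \<open>In a manifold of dimension \<open>CARD('n) + 1\<close> such a frame spans the orthogonal complement of the
  velocity.\<close>

definition normal_parallel_frame :: "('m, 'd::finite) chart set \<Rightarrow> ('m, 'd) metric \<Rightarrow> real \<Rightarrow>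
    (real \<Rightarrow> 'm) \<Rightarrow> ('n::finite \<Rightarrow> real \<Rightarrow> ('m, 'd) tvec) \<Rightarrow> bool" where
  "normal_parallel_frame \<A> g T \<gamma> e \<longleftrightarrow>
     (\<forall>i. smooth_field_along \<A> T \<gamma> (e i) \<and> parallel_along \<A> g T \<gamma> (e i)) \<and>
     (\<forall>t\<in>{0..T}. \<forall>i. metric_at \<A> g (\<gamma> t) (velocity T \<gamma> t) (e i t) = 0 \<and>
        (\<forall>j. metric_at \<A> g (\<gamma> t) (e i t) (e j t) = (if i = j then 1 else 0)))"

definition holonomy_matrix :: "('m, 'd::finite) chart set \<Rightarrow> real \<Rightarrow> (real \<Rightarrow> 'm) \<Rightarrow>
    ('n::finite \<Rightarrow> real \<Rightarrow> ('m, 'd) tvec) \<Rightarrow> real ^ 'n ^ 'n \<Rightarrow> bool" where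
  "holonomy_matrix \<A> T \<gamma> e A \<longleftrightarrow>
     (\<forall>c\<in>\<A>. \<gamma> 0 \<in> fst c \<longrightarrow> (\<forall>j. e j T c = (\<Sum>i\<in>UNIV. A $ i $ j *\<^sub>R e i 0 c)))"

definition curvature_matrix :: "('m, 'd::finite) chart set \<Rightarrow> ('m, 'd) metric \<Rightarrow> real \<Rightarrow>
    (real \<Rightarrow> 'm) \<Rightarrow> ('n::finite \<Rightarrow> real \<Rightarrow> ('m, 'd) tvec) \<Rightarrow> real \<Rightarrow> real ^ 'n ^ 'n" where
  "curvature_matrix \<A> g T \<gamma> e t =
     (\<chi> i j. curvature_at \<A> g (\<gamma> t) (velocity T \<gamma> t) (e i t) (velocity T \<gamma> t) (e j t))"

subsection \<open>Morse index\<close>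

text \<open>In one dimension \<open>W\<^sup>1\<^sup>,\<^sup>2\<close> consists of the absolutely continuous functions with square
  integrable derivative, that is, of the primitives of square integrable functions \<open>w\<close>. By
  Lebesgue's differentiation theorem the classical derivative of such a function exists and equals
  \<open>w\<close> almost everywhere, so it can be used in the index form.\<close>

definition W12 :: "real \<Rightarrow> (real \<Rightarrow> real ^ 'n::finite) set" where
  "W12 T = {u. \<exists>w. w \<in> borel_measurable (lebesgue_on {0..T}) \<and>
      (\<lambda>t. (norm (w t))\<^sup>2) absolutely_integrable_on {0..T} \<and>
      (\<forall>t\<in>{0..T}. u t = u 0 + integral {0..t} w)}"

definition E_space :: "real \<Rightarrow> real ^ 'n ^ 'n \<Rightarrow> (real \<Rightarrow> real ^ 'n::finite) set" where
  "E_space T A = {u \<in> W12 T. u 0 = A *v u T}"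

definition index_form :: "real \<Rightarrow> (real \<Rightarrow> real ^ 'n ^ 'n) \<Rightarrow> (real \<Rightarrow> real ^ 'n::finite) \<Rightarrow>
    (real \<Rightarrow> real ^ 'n) \<Rightarrow> real" where
  "index_form T R u v =
     integral {0..T} (\<lambda>t. vector_derivative u (at t) \<bullet> vector_derivative v (at t)
                          + (R t *v u t) \<bullet> v t)"

text \<open>The functions \<open>b 0, \<dots>, b (k - 1)\<close> are a basis of a \<open>k\<close>-dimensional subspace of \<open>E\<close> on which the
  index form is negative definite. Functions are identified if they agree on \<open>{0..T}\<close>.\<close>

definition negative_subspace_basis :: "real \<Rightarrow> real ^ 'n ^ 'n \<Rightarrow> (real \<Rightarrow> real ^ 'n ^ 'n) \<Rightarrow> nat \<Rightarrow>
    (nat \<Rightarrow> real \<Rightarrow> real ^ 'n::finite) \<Rightarrow> bool" where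
  "negative_subspace_basis T A R k b \<longleftrightarrow>
     (\<forall>i<k. b i \<in> E_space T A) \<and>
     (\<forall>a. (\<forall>t\<in>{0..T}. (\<Sum>i<k. a i *\<^sub>R b i t) = 0) \<longrightarrow> (\<forall>i<k. a i = 0)) \<and>
     (\<forall>a. let u = (\<lambda>t. \<Sum>i<k. a i *\<^sub>R b i t) in
        (\<exists>t\<in>{0..T}. u t \<noteq> 0) \<longrightarrow> index_form T R u u < 0)"

definition morse_index :: "real \<Rightarrow> real ^ 'n ^ 'n \<Rightarrow> (real \<Rightarrow> real ^ 'n::finite ^ 'n) \<Rightarrow> enat" where
  "morse_index T A R = Sup {enat k | k. \<exists>b. negative_subspace_basis T A R k b}"

definition geodesic_morse_index :: "('m, 'd::finite) chart set \<Rightarrow> ('m, 'd) metric \<Rightarrow> real \<Rightarrow>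
    (real \<Rightarrow> 'm) \<Rightarrow> ('n::finite \<Rightarrow> real \<Rightarrow> ('m, 'd) tvec) \<Rightarrow> real ^ 'n ^ 'n \<Rightarrow> enat" where
  "geodesic_morse_index \<A> g T \<gamma> e A = morse_index T A (curvature_matrix \<A> g T \<gamma> e)"

subsection \<open>Iterates\<close>

definition matrix_pow :: "real ^ 'n ^ 'n \<Rightarrow> nat \<Rightarrow> real ^ 'n::finite ^ 'n" where
  "matrix_pow A m = (((**) A) ^^ m) (mat 1)"

definition iterate_curve :: "real \<Rightarrow> (real \<Rightarrow> 'm) \<Rightarrow> real \<Rightarrow> 'm" where
  "iterate_curve T \<gamma> t = \<gamma> (t - of_int \<lfloor>t / T\<rfloor> * T)"

text \<open>The parallel continuation of the frame \<open>e\<close> to the iterate: since \<open>e\<close> at \<open>T\<close> is \<open>e\<close> at \<open>0\<close>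
  times \<open>A\<close>, on \<open>{k * T..<(k + 1) * T}\<close> it is \<open>e\<close> times the \<open>k\<close>-th power of \<open>A\<close>. Its holonomy matrix on
  \<open>{0..m * T}\<close> is the \<open>m\<close>-th power of \<open>A\<close>.\<close>

definition iterate_frame :: "real \<Rightarrow> real ^ 'n ^ 'n \<Rightarrow> ('n::finite \<Rightarrow> real \<Rightarrow> ('m, 'd::finite) tvec) \<Rightarrow>
    'n \<Rightarrow> real \<Rightarrow> ('m, 'd) tvec" where
  "iterate_frame T A e j t =
     (\<lambda>c. \<Sum>i\<in>UNIV. matrix_pow A (nat \<lfloor>t / T\<rfloor>) $ i $ j *\<^sub>R e i (t - of_int \<lfloor>t / T\<rfloor> * T) c)"

subsection \<open>Strong stability\<close>

definition block_matrix :: "'a ^ 'n ^ 'n \<Rightarrow> 'a ^ 'n ^ 'n \<Rightarrow> 'a ^ 'n ^ 'n \<Rightarrow> 'a ^ 'n ^ 'n \<Rightarrow>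
    'a ^ ('n::finite + 'n) ^ ('n + 'n)" where
  "block_matrix A B C D =
     (\<chi> i j. case i of
        Inl k \<Rightarrow> (case j of Inl l \<Rightarrow> A $ k $ l | Inr l \<Rightarrow> B $ k $ l)
      | Inr k \<Rightarrow> (case j of Inl l \<Rightarrow> C $ k $ l | Inr l \<Rightarrow> D $ k $ l))"

definition J_matrix :: "real ^ ('n::finite + 'n) ^ ('n + 'n)" where
  "J_matrix = block_matrix 0 (- mat 1) (mat 1) 0"

definition symplectic :: "real ^ ('n::finite + 'n) ^ ('n + 'n) \<Rightarrow> bool" where
  "symplectic S \<longleftrightarrow> transpose S ** J_matrix ** S = J_matrix"

definition diagonalizable_over_complex :: "real ^ 'k::finite ^ 'k \<Rightarrow> bool" where
  "diagonalizable_over_complex S \<longleftrightarrow>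
     (\<exists>P D :: complex ^ 'k ^ 'k. invertible P \<and> (\<forall>i j. i \<noteq> j \<longrightarrow> D $ i $ j = 0) \<and>
        map_matrix complex_of_real S = P ** D ** matrix_inv P)"

definition linearly_stable :: "real ^ 'k::finite ^ 'k \<Rightarrow> bool" where
  "linearly_stable S \<longleftrightarrow> diagonalizable_over_complex S \<and>
     (\<forall>(\<mu>::complex) (z::complex ^ 'k).
        z \<noteq> 0 \<and> map_matrix complex_of_real S *v z = \<mu> *s z \<longrightarrow> cmod \<mu> = 1)"

text \<open>The norm is the Euclidean norm of the matrix entries; since all norms are equivalent, the notion
  does not depend on this choice.\<close>

definition strongly_stable :: "real ^ ('n::finite + 'n) ^ ('n + 'n) \<Rightarrow> bool" where
  "strongly_stable P \<longleftrightarrow>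
     (\<exists>\<epsilon>>0. \<forall>S. symplectic S \<and> norm (S - P) \<le> \<epsilon> \<longrightarrow> linearly_stable S)"

definition fundamental_solution :: "real \<Rightarrow> (real \<Rightarrow> real ^ 'n ^ 'n) \<Rightarrow>
    (real \<Rightarrow> real ^ ('n::finite + 'n) ^ ('n + 'n)) \<Rightarrow> bool" where
  "fundamental_solution T R \<Psi> \<longleftrightarrow> \<Psi> 0 = mat 1 \<and>
     (\<forall>t\<in>{0..T}. (\<Psi> has_vector_derivative block_matrix 0 (R t) (mat 1) 0 ** \<Psi> t)
                   (at t within {0..T}))"

definition monodromy_matrix :: "real ^ 'n ^ 'n \<Rightarrow> real ^ ('n::finite + 'n) ^ ('n + 'n) \<Rightarrow>
    real ^ ('n + 'n) ^ ('n + 'n)" where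
  "monodromy_matrix A \<Psi>\<^sub>T = block_matrix (matrix_inv (transpose A)) 0 0 A ** \<Psi>\<^sub>T"

end

theory Submission
  imports Defs
begin

text \<open>The monodromy matrix \<open>P\<close> itself is not linearly stable. Let \<open>\<zeta> = a + \<i> b\<close> be an eigenvector of \<open>P\<close> to an
  eigenvalue \<open>cis \<theta>\<close>, and let \<open>x\<close> be the complex solution of the Jacobi equation \<open>x'' = R x\<close> with this initial
  value. If \<open>\<theta> + \<sigma> T\<close> is a rational multiple \<open>2 \<pi> l / m\<close> of \<open>2 \<pi>\<close>, then \<open>cis (\<sigma> t) x\<close> is periodic along the
  \<open>m\<close>-th iterate, and the index form of its real part is \<open>m T \<sigma> \<omega>(a, b) + O(m \<sigma>\<^sup>2)\<close>, where \<open>\<omega>\<close> is the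
  symplectic form, that is, the Wronskian. As this is nonnegative for arbitrarily small \<open>\<sigma>\<close> of either sign,
  \<open>\<omega>(a, b) = 0\<close>: all eigenvectors on the unit circle are isotropic for the Krein form. Eigenspaces to
  different eigenvalues on the unit circle are Krein orthogonal, so if \<open>P\<close> were linearly stable the
  Krein form would vanish, but it is nondegenerate.

  The symmetry of \<open>R\<close>, which makes \<open>P\<close> symplectic, is the pair symmetry of the curvature tensor. The
  continuity of \<open>R\<close> is never needed: \<open>R x\<close> is integrable because it is a derivative.\<close>

subsection \<open>Matrices\<close>

lemma inner_matrix_vector_transpose:
  fixes M :: "real ^ 'n ^ 'm"
  shows "(M *v v) \<bullet> w = v \<bullet> (transpose M *v w)"
  by (metis dot_lmul_matrix vector_transpose_matrix)

lemma symmetric_matrix_inner: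
  fixes M :: "real ^ 'n ^ 'n"
  assumes "transpose M = M"
  shows "v \<bullet> (M *v w) = w \<bullet> (M *v v)"
  by (metis assms inner_commute inner_matrix_vector_transpose)

lemma orthogonal_matrix_inner:
  fixes B :: "real ^ 'n ^ 'n"
  assumes "orthogonal_matrix B"
  shows "(B *v v) \<bullet> (B *v w) = v \<bullet> w"
  using assms by (simp add: inner_matrix_vector_transpose matrix_vector_mul_assoc orthogonal_matrix)

subsection \<open>Mixed second derivatives\<close>

text \<open>Schwarz's theorem under the weak hypothesis that the first derivatives are differentiable at the
  point. The mean value theorem is applied in the direction \<open>v\<close> only; the quotient is symmetric in
  \<open>v\<close> and \<open>w\<close>.\<close>

lemma mixed_difference_quotient:
  fixes f :: "'a::real_normed_vector \<Rightarrow> real"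
  assumes "open S" "x \<in> S"
    and f: "\<And>y. y \<in> S \<Longrightarrow> (f has_derivative f' y) (at y)"
    and A: "((\<lambda>y. f' y v) has_derivative A) (at x)"
  shows "((\<lambda>h. (f (x + h *\<^sub>R v + h *\<^sub>R w) - f (x + h *\<^sub>R v) - f (x + h *\<^sub>R w) + f x) / h\<^sup>2)
           \<longlongrightarrow> A w) (at_right 0)"
proof (rule tendstoI)
  fix e :: real assume "e > 0"
  \<comment> \<open>\<open>K\<close> exceeds \<open>2 * (norm v + norm w)\<close>, so that two
    linearisation errors of rate \<open>e / K\<close> add up to strictly less than
    \<open>e * h\<close>; the summand 1 keeps \<open>K\<close> positive when both vectors
    vanish.\<close>
  define K where "K = 2 * (norm v + norm w) + 1"
  have K: "K > 0" by (simp add: K_def add_nonneg_pos)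
  interpret A: bounded_linear A using A by (rule has_derivative_bounded_linear)
  obtain r where r: "r > 0" "ball x r \<subseteq> S"
    using assms(1,2) openE by blast
  obtain d where d: "d > 0" "\<And>y. norm (y - x) < d \<Longrightarrow>
      \<bar>f' y v - f' x v - A (y - x)\<bar> \<le> e / K * norm (y - x)"
    using A \<open>e > 0\<close> K unfolding has_derivative_within_alt real_norm_def
    by (metis UNIV_I divide_pos_pos)
  have "eventually (\<lambda>h. h < min r d / K) (at_right (0::real))"
    using r d K by (intro order_tendstoD(2)[OF tendsto_ident_at]) auto
  then show "\<forall>\<^sub>F h in at_right 0. dist ((f (x + h *\<^sub>R v + h *\<^sub>R w) - f (x + h *\<^sub>R v)
      - f (x + h *\<^sub>R w) + f x) / h\<^sup>2) (A w) < e"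
    using eventually_at_right_less[of "0::real"]
  proof eventually_elim
    fix h :: real assume h: "h < min r d / K" "0 < h"
    then have hK: "h * K < min r d" using K by (simp add: field_simps)
    have nb: "norm (s *\<^sub>R v + t *\<^sub>R w) \<le> h * (norm v + norm w)"
      if "0 \<le> s" "s \<le> h" "0 \<le> t" "t \<le> h" for s t
      using that by (intro order_trans[OF norm_triangle_ineq])
        (auto simp: distrib_left intro!: add_mono mult_right_mono)
    have small: "h * (norm v + norm w) < min r d"
    proof -
      have "h * (norm v + norm w) \<le> h * K"
        using h by (intro mult_left_mono) (auto simp: K_def)
      with hK show ?thesis by linarith
    qed
    have inS: "x + s *\<^sub>R v + t *\<^sub>R w \<in> S" if "0 \<le> s" "s \<le> h" "0 \<le> t" "t \<le> h" for s t
    proof -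
      have "norm (s *\<^sub>R v + t *\<^sub>R w) < r" using nb[OF that] small by linarith
      then have "x + s *\<^sub>R v + t *\<^sub>R w \<in> ball x r"
        by (simp add: mem_ball dist_commute[of x]) (simp add: dist_norm add.assoc)
      with r show ?thesis by blast
    qed
    define \<phi> where "\<phi> s = f (x + s *\<^sub>R v + h *\<^sub>R w) - f (x + s *\<^sub>R v)" for s
    define \<phi>' where "\<phi>' s = f' (x + s *\<^sub>R v + h *\<^sub>R w) v - f' (x + s *\<^sub>R v) v" for s
    have der: "(\<phi> has_real_derivative \<phi>' s) (at s)" if s: "0 \<le> s" "s \<le> h" for s
    proof -
      have S1: "x + s *\<^sub>R v + h *\<^sub>R w \<in> S" "x + s *\<^sub>R v \<in> S"
        using inS[of s h] inS[of s 0] s h by auto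
      have l1: "linear (f' (x + s *\<^sub>R v + h *\<^sub>R w))" "linear (f' (x + s *\<^sub>R v))"
        using f[OF S1(1)] f[OF S1(2)] by (auto intro: has_derivative_linear)
      have "((\<lambda>s. f (x + s *\<^sub>R v + h *\<^sub>R w)) has_derivative (\<lambda>k. f' (x + s *\<^sub>R v + h *\<^sub>R w) (k *\<^sub>R v))) (at s)"
        using S1 by (intro has_derivative_compose[OF _ f, where f = "\<lambda>s. x + s *\<^sub>R v + h *\<^sub>R w"])
          (auto intro!: derivative_eq_intros)
      moreover have "((\<lambda>s. f (x + s *\<^sub>R v)) has_derivative (\<lambda>k. f' (x + s *\<^sub>R v) (k *\<^sub>R v))) (at s)"
        using S1 by (intro has_derivative_compose[OF _ f, where f = "\<lambda>s. x + s *\<^sub>R v"])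
          (auto intro!: derivative_eq_intros)
      ultimately have "(\<phi> has_derivative (\<lambda>k. f' (x + s *\<^sub>R v + h *\<^sub>R w) (k *\<^sub>R v) - f' (x + s *\<^sub>R v) (k *\<^sub>R v))) (at s)"
        unfolding \<phi>_def by (rule has_derivative_diff)
      then show ?thesis
        by (rule has_derivative_imp_has_field_derivative)
          (simp add: \<phi>'_def linear_cmul[OF l1(1)] linear_cmul[OF l1(2)] right_diff_distrib mult.commute)
    qed
    obtain s where s: "0 < s" "s < h" "\<phi> h - \<phi> 0 = (h - 0) * \<phi>' s"
      using MVT2[of 0 h \<phi> \<phi>'] der h by auto
    have e1: "\<bar>f' (x + s *\<^sub>R v + h *\<^sub>R w) v - f' x v - A (s *\<^sub>R v + h *\<^sub>R w)\<bar> \<le> e / K * (h * (norm v + norm w))"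
    proof -
      have n: "norm (s *\<^sub>R v + h *\<^sub>R w) \<le> h * (norm v + norm w)" using nb[of s h] s h by auto
      have "\<bar>f' (x + s *\<^sub>R v + h *\<^sub>R w) v - f' x v - A (s *\<^sub>R v + h *\<^sub>R w)\<bar> \<le> e / K * norm (s *\<^sub>R v + h *\<^sub>R w)"
        using d(2)[of "x + s *\<^sub>R v + h *\<^sub>R w"] n small by (simp add: add.assoc)
      also have "\<dots> \<le> e / K * (h * (norm v + norm w))"
        using n \<open>e > 0\<close> K by (intro mult_left_mono) auto
      finally show ?thesis .
    qed
    have e2: "\<bar>f' (x + s *\<^sub>R v) v - f' x v - A (s *\<^sub>R v)\<bar> \<le> e / K * (h * (norm v + norm w))"
    proof -
      have n: "norm (s *\<^sub>R v) \<le> h * (norm v + norm w)" using nb[of s 0] s h by auto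
      have "\<bar>f' (x + s *\<^sub>R v) v - f' x v - A (s *\<^sub>R v)\<bar> \<le> e / K * norm (s *\<^sub>R v)"
        using d(2)[of "x + s *\<^sub>R v"] n small by simp
      also have "\<dots> \<le> e / K * (h * (norm v + norm w))"
        using n \<open>e > 0\<close> K by (intro mult_left_mono) auto
      finally show ?thesis .
    qed
    \<comment> \<open>The contributions \<open>A (s *\<^sub>R v)\<close> of the two linearisations
      cancel in the difference. The unknown intermediate point \<open>s\<close> therefore disappears
      from the main term \<open>h * A w\<close>.\<close>
    have "\<bar>\<phi>' s - h * A w\<bar> \<le> 2 * (e / K * (h * (norm v + norm w)))"
      using e1 e2 unfolding \<phi>'_def by (simp add: A.add A.scaleR)
    also have "\<dots> = e * h * (2 * (norm v + norm w) / K)"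
      by (simp add: field_simps)
    also have "\<dots> < e * h * 1"
      using \<open>e > 0\<close> h K by (intro mult_strict_left_mono) (auto simp: K_def field_simps)
    finally have b: "\<bar>\<phi>' s - h * A w\<bar> < e * h" by simp
    have "(f (x + h *\<^sub>R v + h *\<^sub>R w) - f (x + h *\<^sub>R v) - f (x + h *\<^sub>R w) + f x) / h\<^sup>2 = (\<phi> h - \<phi> 0) / h\<^sup>2"
      by (simp add: \<phi>_def)
    also have "\<dots> = \<phi>' s / h"
      using s h by (simp add: power2_eq_square)
    finally have e3: "(f (x + h *\<^sub>R v + h *\<^sub>R w) - f (x + h *\<^sub>R v) - f (x + h *\<^sub>R w) + f x) / h\<^sup>2 - A w
        = (\<phi>' s - h * A w) / h" using h by (simp add: field_simps)
    then show "dist ((f (x + h *\<^sub>R v + h *\<^sub>R w) - f (x + h *\<^sub>R v) - f (x + h *\<^sub>R w) + f x) / h\<^sup>2) (A w) < e"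
      unfolding dist_real_def e3 using b h by (simp add: abs_divide pos_divide_less_eq)
  qed
qed

lemma mixed_derivatives_commute:
  fixes f :: "'a::real_normed_vector \<Rightarrow> real"
  assumes "open S" "x \<in> S"
    and f: "\<And>y. y \<in> S \<Longrightarrow> (f has_derivative f' y) (at y)"
    and A: "((\<lambda>y. f' y v) has_derivative A) (at x)"
    and B: "((\<lambda>y. f' y w) has_derivative B) (at x)"
  shows "A w = B v"
proof (rule tendsto_unique[OF _ mixed_difference_quotient[OF assms(1,2) f A]])
  show "((\<lambda>h. (f (x + h *\<^sub>R v + h *\<^sub>R w) - f (x + h *\<^sub>R v) - f (x + h *\<^sub>R w) + f x) / h\<^sup>2)
           \<longlongrightarrow> B v) (at_right 0)"
    using mixed_difference_quotient[OF assms(1,2) f B, of v]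
    by (simp add: algebra_simps)
qed simp_all

subsection \<open>Symmetry of the curvature\<close>

lemma smooth_on_has_derivative:
  assumes "smooth_on S f" "open S" "x \<in> S"
  shows "(f has_derivative frechet_derivative f (at x)) (at x)"
proof -
  have "Ck_on (Suc 0) S f" using assms(1) unfolding smooth_on_def by blast
  then have "f differentiable (at x within S)"
    using assms(3) by (simp add: differentiable_on_def)
  then have "f differentiable (at x)"
    by (simp only: at_within_open[OF assms(3,2)])
  then show ?thesis by (simp add: frechet_derivative_works)
qed

text \<open>\<open>Ck_on\<close> differentiates within \<open>S\<close>. As \<open>S\<close> is
  open, the inner derivative at all points of \<open>S\<close> and the outer one at \<open>x\<close>
  become unrestricted derivatives.\<close>

lemma smooth_on_second_derivative:
  assumes "smooth_on S f" "open S" "x \<in> S"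
  shows "((\<lambda>y. frechet_derivative f (at y) v) has_derivative
           frechet_derivative (\<lambda>y. frechet_derivative f (at y) v) (at x)) (at x)"
proof -
  have "Ck_on (Suc (Suc 0)) S f" using assms(1) unfolding smooth_on_def by blast
  then have "(\<lambda>y. frechet_derivative f (at y within S) v) differentiable (at x within S)"
    using assms(3) by (simp add: differentiable_on_def)
  then have "(\<lambda>y. frechet_derivative f (at y within S) v) differentiable (at x)"
    by (simp only: at_within_open[OF assms(3,2)])
  then obtain D where "((\<lambda>y. frechet_derivative f (at y within S) v) has_derivative D) (at x)"
    by (auto simp: differentiable_def)
  then have "((\<lambda>y. frechet_derivative f (at y) v) has_derivative D) (at x)"
    by (rule has_derivative_transform_within_open[OF _ assms(2,3)])
      (simp add: at_within_open[OF _ assms(2)])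
  then show ?thesis by (metis differentiableI frechet_derivative_works)
qed

text \<open>Schwarz's theorem applied to each component \<open>G y \<bullet> b\<close>.\<close>

lemma smooth_on_second_derivative_commute:
  fixes G :: "'a::euclidean_space \<Rightarrow> 'b::euclidean_space"
  assumes "smooth_on S G" "open S" "x \<in> S"
  shows "frechet_derivative (\<lambda>y. frechet_derivative G (at y) v) (at x) w
       = frechet_derivative (\<lambda>y. frechet_derivative G (at y) w) (at x) v"
proof (rule euclidean_eqI)
  fix b :: 'b
  show "frechet_derivative (\<lambda>y. frechet_derivative G (at y) v) (at x) w \<bullet> b
       = frechet_derivative (\<lambda>y. frechet_derivative G (at y) w) (at x) v \<bullet> b"
    by (rule mixed_derivatives_commute[OF assms(2,3)
          bounded_linear.has_derivative[OF bounded_linear_inner_left smooth_on_has_derivative[OF assms(1,2)]]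
          bounded_linear.has_derivative[OF bounded_linear_inner_left smooth_on_second_derivative[OF assms]]
          bounded_linear.has_derivative[OF bounded_linear_inner_left smooth_on_second_derivative[OF assms]]])
qed

section \<open>Christoffel symbols and the Koszul formula\<close>

lemma inner_matrix_vector_sum:
  fixes M :: "real ^ 'n ^ 'm"
  shows "v \<bullet> (M *v w) = (\<Sum>i\<in>UNIV. \<Sum>j\<in>UNIV. v $ i * w $ j * M $ i $ j)"
  by (simp add: inner_vec_def matrix_vector_mult_def sum_distrib_left ac_simps)

lemma bounded_linear_vec_nth_nth: "bounded_linear (\<lambda>M :: real ^ 'n ^ 'm. M $ i $ j)"
  using bounded_linear_compose[OF bounded_linear_vec_nth bounded_linear_vec_nth] .

lemma bounded_linear_transpose: "bounded_linear (transpose :: real ^ 'n ^ 'm \<Rightarrow> _)"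
  by (intro linear_conv_bounded_linear[THEN iffD1] linearI) (auto simp: transpose_def vec_eq_iff)

lemma partial_matrix_entry:
  fixes G :: "real ^ 'd::finite \<Rightarrow> real ^ 'd ^ 'd"
  assumes "(G has_derivative D) (at x)"
  shows "partial i (\<lambda>y. G y $ j $ l) x = D (axis i 1) $ j $ l"
proof -
  have "((\<lambda>y. G y $ j $ l) has_derivative (\<lambda>h. D h $ j $ l)) (at x)"
    using bounded_linear.has_derivative[OF bounded_linear_vec_nth_nth assms] .
  then show ?thesis
    unfolding partial_def by (simp add: frechet_derivative_at[symmetric])
qed

lemma linear_axis_sum:
  fixes D :: "real ^ 'd::finite \<Rightarrow> real ^ 'n ^ 'm"
  assumes "linear D"
  shows "(\<Sum>i\<in>UNIV. v $ i * D (axis i 1) $ j $ l) = D v $ j $ l"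
proof -
  have "D v = D (\<Sum>i\<in>UNIV. v $ i *\<^sub>R axis i 1)"
    using basis_expansion[of v] by (simp add: scalar_mult_eq_scaleR)
  also have "\<dots> = (\<Sum>i\<in>UNIV. v $ i *\<^sub>R D (axis i 1))"
    using assms by (simp add: linear_sum linear_cmul)
  finally show ?thesis by (simp add: sum_component)
qed

text \<open>The right-hand side of the Koszul formula for fields with constant coordinates, whose
  Lie brackets vanish: the covariant derivative of \<open>w\<close> along \<open>v\<close>, paired
  with \<open>y\<close>.\<close>

definition koszul :: "(real ^ 'd \<Rightarrow> real ^ 'd ^ 'd) \<Rightarrow> real ^ 'd::finite \<Rightarrow>
    real ^ 'd \<Rightarrow> real ^ 'd \<Rightarrow> real ^ 'd \<Rightarrow> real" where
  "koszul G x v w y = (w \<bullet> (frechet_derivative G (at x) v *v y)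
     + v \<bullet> (frechet_derivative G (at x) w *v y) - v \<bullet> (frechet_derivative G (at x) y *v w)) / 2"

lemma sum_swap3:
  fixes f :: "'a::finite \<Rightarrow> 'a \<Rightarrow> 'a \<Rightarrow> real"
  shows "(\<Sum>k\<in>UNIV. \<Sum>i\<in>UNIV. \<Sum>j\<in>UNIV. f i j k) = (\<Sum>i\<in>UNIV. \<Sum>j\<in>UNIV. \<Sum>k\<in>UNIV. f i j k)"
  by (subst sum.swap) (rule sum.cong[OF refl], rule sum.swap)

text \<open>Contracting the Christoffel symbols with \<open>v\<close> and \<open>w\<close> turns
  partial derivatives of \<open>G\<close> into directional ones, by linearity of the derivative. The
  inverse Gram matrix only raises the index and can be pulled out.\<close>

lemma connection_form_eq:
  fixes G :: "real ^ 'd::finite \<Rightarrow> real ^ 'd ^ 'd"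
  assumes G: "(G has_derivative frechet_derivative G (at x)) (at x)"
  shows "connection_form G x v w = matrix_inv (G x) *v (\<chi> l. koszul G x v w (axis l 1))"
proof -
  let ?D = "frechet_derivative G (at x)"
  have D: "linear ?D" using G by (rule has_derivative_linear)
  have lower: "(\<Sum>i\<in>UNIV. \<Sum>j\<in>UNIV. (?D (axis i 1) $ j $ l + ?D (axis j 1) $ i $ l - ?D (axis l 1) $ i $ j)
       * v $ i * w $ j) / 2 = koszul G x v w (axis l 1)" for l
  proof -
    have e: "u \<bullet> (M *v axis l 1) = (\<Sum>j\<in>UNIV. u $ j * M $ j $ l)" for u :: "real^'d" and M :: "real^'d^'d"
      by (simp add: inner_vec_def column_def matrix_vector_mult_basis)
    have 1: "(\<Sum>i\<in>UNIV. \<Sum>j\<in>UNIV. ?D (axis i 1) $ j $ l * v $ i * w $ j) = w \<bullet> (?D v *v axis l 1)"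
    proof -
      have "(\<Sum>i\<in>UNIV. ?D (axis i 1) $ j $ l * v $ i * w $ j) = w $ j * ?D v $ j $ l" for j
        unfolding linear_axis_sum[OF D, of v j l, symmetric] by (simp add: sum_distrib_left ac_simps)
      then show ?thesis unfolding e by (subst sum.swap) (rule sum.cong[OF refl])
    qed
    have 2: "(\<Sum>i\<in>UNIV. \<Sum>j\<in>UNIV. ?D (axis j 1) $ i $ l * v $ i * w $ j) = v \<bullet> (?D w *v axis l 1)"
    proof -
      have "(\<Sum>j\<in>UNIV. ?D (axis j 1) $ i $ l * v $ i * w $ j) = v $ i * ?D w $ i $ l" for i
        unfolding linear_axis_sum[OF D, of w i l, symmetric] by (simp add: sum_distrib_left ac_simps)
      then show ?thesis unfolding e by (intro sum.cong refl)
    qed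
    have 3: "(\<Sum>i\<in>UNIV. \<Sum>j\<in>UNIV. ?D (axis l 1) $ i $ j * v $ i * w $ j) = v \<bullet> (?D (axis l 1) *v w)"
      by (simp add: inner_matrix_vector_sum ac_simps)
    show ?thesis
      unfolding koszul_def 1[symmetric] 2[symmetric] 3[symmetric]
      by (simp add: left_diff_distrib distrib_right sum.distrib sum_subtractf)
  qed
  show ?thesis
  proof (rule vec_eq_iff[THEN iffD2], rule allI)
    fix k
    have "connection_form G x v w $ k = (\<Sum>i\<in>UNIV. \<Sum>j\<in>UNIV. \<Sum>l\<in>UNIV. matrix_inv (G x) $ k $ l *
        ((?D (axis i 1) $ j $ l + ?D (axis j 1) $ i $ l - ?D (axis l 1) $ i $ j) * v $ i * w $ j / 2))"
      by (simp add: connection_form_def christoffel_def partial_matrix_entry[OF G] sum_distrib_right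
          sum_divide_distrib mult.assoc)
    also have "\<dots> = (\<Sum>l\<in>UNIV. \<Sum>i\<in>UNIV. \<Sum>j\<in>UNIV. matrix_inv (G x) $ k $ l *
        ((?D (axis i 1) $ j $ l + ?D (axis j 1) $ i $ l - ?D (axis l 1) $ i $ j) * v $ i * w $ j / 2))"
      by (rule sum_swap3[symmetric])
    also have "\<dots> = (\<Sum>l\<in>UNIV. matrix_inv (G x) $ k $ l * koszul G x v w (axis l 1))"
      unfolding lower[symmetric] by (simp add: sum_distrib_left sum_divide_distrib)
    finally show "connection_form G x v w $ k = (matrix_inv (G x) *v (\<chi> l. koszul G x v w (axis l 1))) $ k"
      by (simp add: matrix_vector_mult_def)
  qed
qed

lemma koszul_linear:
  assumes G: "(G has_derivative frechet_derivative G (at x)) (at x)"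
  shows "linear (koszul G x v w)"
proof -
  have D: "linear (frechet_derivative G (at x))" using G by (rule has_derivative_linear)
  show ?thesis
  proof (rule linearI)
    show "koszul G x v w (a + b) = koszul G x v w a + koszul G x v w b" for a b
      unfolding koszul_def linear_add[OF D] matrix_vector_right_distrib
        matrix_vector_mult_add_rdistrib inner_add_right by (simp add: field_simps)
    show "koszul G x v w (r *\<^sub>R b) = r *\<^sub>R koszul G x v w b" for r b
      unfolding koszul_def linear_cmul[OF D] matrix_vector_mult_scaleR
        scaleR_matrix_vector_assoc[symmetric] inner_scaleR_right
      by (simp add: field_simps)
  qed
qed

lemma matrix_inv_inverse:
  assumes "invertible (M :: 'a::semiring_1 ^ 'n ^ 'm)"
  shows "M ** matrix_inv M = mat 1 \<and> matrix_inv M ** M = mat 1"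
  using assms unfolding invertible_def matrix_inv_def by (rule someI_ex)

text \<open>\<open>G x\<close> cancels its inverse, and linearity of \<open>koszul\<close> in the
  last argument reassembles \<open>y\<close> from the axis vectors.\<close>

lemma connection_form_lower:
  fixes G :: "real ^ 'd::finite \<Rightarrow> real ^ 'd ^ 'd"
  assumes G: "(G has_derivative frechet_derivative G (at x)) (at x)"
    and "invertible (G x)" and sym: "transpose (G x) = G x"
  shows "connection_form G x v w \<bullet> (G x *v y) = koszul G x v w y"
proof -
  let ?L = "\<chi> l. koszul G x v w (axis l 1)"
  have "connection_form G x v w \<bullet> (G x *v y) = y \<bullet> ((G x ** matrix_inv (G x)) *v ?L)"
    by (simp add: symmetric_matrix_inner[OF sym] connection_form_eq[OF G] matrix_vector_mul_assoc)
  also have "\<dots> = y \<bullet> ?L"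
    using matrix_inv_inverse[OF assms(2)] by simp
  also have "\<dots> = koszul G x v w (\<Sum>l\<in>UNIV. y $ l *\<^sub>R axis l 1)"
    using koszul_linear[OF G] by (simp add: inner_vec_def linear_sum linear_cmul)
  also have "\<dots> = koszul G x v w y"
    using basis_expansion[of y] by (simp add: scalar_mult_eq_scaleR)
  finally show ?thesis .
qed

lemma differentiable_prod:
  fixes f :: "'i \<Rightarrow> 'a::real_normed_vector \<Rightarrow> 'b::real_normed_field"
  assumes "\<And>i. i \<in> I \<Longrightarrow> f i differentiable (at x within s)"
  shows "(\<lambda>y. \<Prod>i\<in>I. f i y) differentiable (at x within s)"
  using assms by (induction I rule: infinite_finite_induct) auto

text \<open>The Leibniz formula is a polynomial in the entries. With Cramer's rule this yields the
  differentiability of the connection form.\<close>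

lemma differentiable_det:
  fixes M :: "'a::real_normed_vector \<Rightarrow> real ^ 'n ^ 'n"
  assumes "\<And>i j. (\<lambda>y. M y $ i $ j) differentiable (at x within s)"
  shows "(\<lambda>y. det (M y)) differentiable (at x within s)"
  unfolding det_def
  by (intro differentiable_sum ballI differentiable_mult differentiable_const differentiable_prod assms)
    (simp add: finite_permutations)

text \<open>A metric in the coordinates of one chart. Nondegeneracy stands in place of a signature,
  so that the Riemannian and the Lorentzian case are treated together.\<close>

locale metric_on_open_set =
  fixes G :: "real ^ 'd::finite \<Rightarrow> real ^ 'd ^ 'd" and S :: "(real ^ 'd) set"
  assumes open_S: "open S"
    and smooth: "smooth_on S G"
    and sym: "x \<in> S \<Longrightarrow> transpose (G x) = G x"
    and nondegenerate: "x \<in> S \<Longrightarrow> invertible (G x)"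
begin

definition D :: "real ^ 'd \<Rightarrow> real ^ 'd \<Rightarrow> real ^ 'd ^ 'd" where
  "D x = frechet_derivative G (at x)"

definition D2 :: "real ^ 'd \<Rightarrow> real ^ 'd \<Rightarrow> real ^ 'd \<Rightarrow> real ^ 'd ^ 'd" where
  "D2 x v = frechet_derivative (\<lambda>y. D y v) (at x)"

lemma has_derivative_G: "x \<in> S \<Longrightarrow> (G has_derivative D x) (at x)"
  unfolding D_def by (rule smooth_on_has_derivative[OF smooth open_S])

lemma has_derivative_D: "x \<in> S \<Longrightarrow> ((\<lambda>y. D y v) has_derivative D2 x v) (at x)"
  unfolding D2_def unfolding D_def by (rule smooth_on_second_derivative[OF smooth open_S])

lemma D2_commute: "x \<in> S \<Longrightarrow> D2 x v w = D2 x w v"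
  unfolding D2_def unfolding D_def by (rule smooth_on_second_derivative_commute[OF smooth open_S])

text \<open>Both \<open>G\<close> and its transpose have a derivative at \<open>x\<close>, and they
  agree on the open set \<open>S\<close>; derivatives are unique.\<close>

lemma transpose_D:
  assumes "x \<in> S"
  shows "transpose (D x v) = D x v"
proof -
  have "((\<lambda>y. transpose (G y)) has_derivative (\<lambda>h. transpose (D x h))) (at x)"
    by (rule bounded_linear.has_derivative[OF bounded_linear_transpose has_derivative_G[OF assms]])
  then have "(G has_derivative (\<lambda>h. transpose (D x h))) (at x)"
    by (rule has_derivative_transform_within_open[OF _ open_S assms]) (simp add: sym)
  from has_derivative_unique[OF this has_derivative_G[OF assms]] show ?thesis
    by (rule fun_cong)
qed

lemma transpose_D2:
  assumes "x \<in> S"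
  shows "transpose (D2 x v w) = D2 x v w"
proof -
  have "((\<lambda>y. transpose (D y v)) has_derivative (\<lambda>h. transpose (D2 x v h))) (at x)"
    by (rule bounded_linear.has_derivative[OF bounded_linear_transpose has_derivative_D[OF assms]])
  then have "((\<lambda>y. D y v) has_derivative (\<lambda>h. transpose (D2 x v h))) (at x)"
    by (rule has_derivative_transform_within_open[OF _ open_S assms]) (simp add: transpose_D)
  from has_derivative_unique[OF this has_derivative_D[OF assms]] show ?thesis
    by (rule fun_cong)
qed

lemma koszul_D: "koszul G x v w y = (w \<bullet> (D x v *v y) + v \<bullet> (D x w *v y) - v \<bullet> (D x y *v w)) / 2"
  by (simp add: koszul_def D_def)

lemma lower:
  assumes "x \<in> S"
  shows "connection_form G x v w \<bullet> (G x *v y) = koszul G x v w y"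
  by (rule connection_form_lower[OF has_derivative_G[OF assms, unfolded D_def]
        nondegenerate[OF assms] sym[OF assms]])

text \<open>The connection is torsion free: exchanging \<open>v\<close> and \<open>w\<close> in
  \<open>koszul\<close> permutes its first two terms and transposes the third.\<close>

lemma connection_form_commute:
  assumes "x \<in> S"
  shows "connection_form G x v w = connection_form G x w v"
  unfolding connection_form_eq[OF has_derivative_G[OF assms, unfolded D_def]] koszul_D
    symmetric_matrix_inner[OF transpose_D[OF assms], of v _ w]
  by (simp add: add.commute)

text \<open>The metric is parallel. In the sum of the two Koszul expressions, all terms that
  differentiate in direction \<open>v\<close> or \<open>w\<close> cancel.\<close>

lemma metric_compatible:
  assumes "x \<in> S"
  shows "v \<bullet> (D x u *v w) =
    connection_form G x u v \<bullet> (G x *v w) + connection_form G x u w \<bullet> (G x *v v)"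
  unfolding lower[OF assms] koszul_D
  using symmetric_matrix_inner[OF transpose_D[OF assms]]
  by (simp add: field_simps)

lemma differentiable_connection_form:
  assumes "x \<in> S"
  shows "(\<lambda>y. connection_form G y v w) differentiable (at x)"
proof -
  define b where "b y = (\<chi> l. koszul G y v w (axis l 1))" for y
  have dG: "(\<lambda>y. G y $ i $ j) differentiable (at x)" for i j
    using bounded_linear.has_derivative[OF bounded_linear_vec_nth_nth has_derivative_G[OF assms]]
    by (rule differentiableI)
  have dD: "(\<lambda>y. D y u $ i $ j) differentiable (at x)" for u i j
    using bounded_linear.has_derivative[OF bounded_linear_vec_nth_nth has_derivative_D[OF assms]]
    by (rule differentiableI)
  have db: "(\<lambda>y. b y $ i) differentiable (at x)" for i
    unfolding b_def vec_lambda_beta koszul_D inner_matrix_vector_sum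
    by (intro differentiable_divide differentiable_add differentiable_diff differentiable_sum
        differentiable_mult dD differentiable_const ballI) auto
  have d0: "det (G y) \<noteq> 0" if "y \<in> S" for y
    using nondegenerate[OF that] by (simp add: invertible_det_nz)
  \<comment> \<open>Cramer's rule: the connection form solves a linear system with matrix
    \<open>G y\<close> and right-hand side \<open>b y\<close>, whose entries are
    differentiable.\<close>
  have eq: "connection_form G y v w $ k = det (\<chi> i j. if j = k then b y $ i else G y $ i $ j) / det (G y)"
    if y: "y \<in> S" for y k
  proof -
    have "G y *v connection_form G y v w = (G y ** matrix_inv (G y)) *v b y"
      using connection_form_eq[of G y v w] has_derivative_G[OF y]
      by (simp add: D_def b_def matrix_vector_mul_assoc)
    also have "\<dots> = b y" using matrix_inv_inverse[OF nondegenerate[OF y]] by simp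
    finally show ?thesis using cramer[OF d0[OF y]] by simp
  qed
  have "(\<lambda>y. connection_form G y v w $ k) differentiable (at x)" for k
  proof -
    have "(\<lambda>y. det (\<chi> i j. if j = k then b y $ i else G y $ i $ j) / det (G y)) differentiable (at x)"
    proof (intro differentiable_divide differentiable_det dG d0 assms)
      show "(\<lambda>y. (\<chi> i j. if j = k then b y $ i else G y $ i $ j) $ i $ j) differentiable (at x)" for i j
        by (cases "j = k") (simp_all add: db dG)
    qed
    then obtain E where "((\<lambda>y. det (\<chi> i j. if j = k then b y $ i else G y $ i $ j) / det (G y)) has_derivative E) (at x)"
      by (auto simp: differentiable_def)
    then have "((\<lambda>y. connection_form G y v w $ k) has_derivative E) (at x)"
      by (rule has_derivative_transform_within_open[OF _ open_S assms]) (simp add: eq)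
    then show ?thesis by (rule differentiableI)
  qed
  then show ?thesis
    by (subst differentiable_componentwise_within) (auto simp: Basis_vec_def inner_axis)
qed

text \<open>The left side pairs with \<open>z\<close> the second covariant derivative of the
  constant field \<open>w\<close>, first along \<open>v\<close>, then along \<open>u\<close>. It is
  computed by differentiating the identity \<open>lower\<close> and replacing the derivative of
  \<open>G\<close> by \<open>metric_compatible\<close>.\<close>

lemma derivative_connection_form_lower:
  assumes x: "x \<in> S"
  shows "(frechet_derivative (\<lambda>y. connection_form G y v w) (at x) u
            + connection_form G x u (connection_form G x v w)) \<bullet> (G x *v z) =
         (w \<bullet> (D2 x v u *v z) + v \<bullet> (D2 x w u *v z) - v \<bullet> (D2 x z u *v w)) / 2
            - connection_form G x u z \<bullet> (G x *v connection_form G x v w)"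
proof -
  let ?\<Gamma> = "\<lambda>y. connection_form G y v w"
  have mv: "bounded_linear (\<lambda>M :: real ^ 'd ^ 'd. p \<bullet> (M *v q))" for p q
    by (intro linear_conv_bounded_linear[THEN iffD1] linearI)
      (simp_all add: matrix_vector_mult_add_rdistrib inner_add_right scaleR_matrix_vector_assoc[symmetric])
  have mv': "bounded_linear (\<lambda>M :: real ^ 'd ^ 'd. M *v q)" for q
    by (intro linear_conv_bounded_linear[THEN iffD1] linearI)
      (simp_all add: matrix_vector_mult_add_rdistrib scaleR_matrix_vector_assoc[symmetric])
  have \<Gamma>: "(?\<Gamma> has_derivative frechet_derivative ?\<Gamma> (at x)) (at x)"
    using differentiable_connection_form[OF x] by (simp add: frechet_derivative_works)
  have 1: "((\<lambda>y. ?\<Gamma> y \<bullet> (G y *v z)) has_derivative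
      (\<lambda>h. ?\<Gamma> x \<bullet> (D x h *v z) + frechet_derivative ?\<Gamma> (at x) h \<bullet> (G x *v z))) (at x)"
    by (rule has_derivative_inner[OF \<Gamma> bounded_linear.has_derivative[OF mv' has_derivative_G[OF x]]])
  have 2: "((\<lambda>y. koszul G y v w z) has_derivative
      (\<lambda>h. (w \<bullet> (D2 x v h *v z) + v \<bullet> (D2 x w h *v z) - v \<bullet> (D2 x z h *v w)) / 2)) (at x)"
    unfolding koszul_D divide_real_def
    by (intro has_derivative_mult_left has_derivative_add has_derivative_diff
        bounded_linear.has_derivative[OF mv has_derivative_D[OF x]])
  have "((\<lambda>y. ?\<Gamma> y \<bullet> (G y *v z)) has_derivative
      (\<lambda>h. (w \<bullet> (D2 x v h *v z) + v \<bullet> (D2 x w h *v z) - v \<bullet> (D2 x z h *v w)) / 2)) (at x)"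
    by (rule has_derivative_transform_within_open[OF 2 open_S x]) (simp add: lower)
  from fun_cong[OF has_derivative_unique[OF 1 this], of u]
  have "?\<Gamma> x \<bullet> (D x u *v z) + frechet_derivative ?\<Gamma> (at x) u \<bullet> (G x *v z) =
      (w \<bullet> (D2 x v u *v z) + v \<bullet> (D2 x w u *v z) - v \<bullet> (D2 x z u *v w)) / 2" .
  then show ?thesis
    unfolding metric_compatible[OF x] inner_add_left by linarith
qed

lemma curvature_tensor_eq:
  assumes "x \<in> S"
  shows "curvature_tensor G x v w z =
    (frechet_derivative (\<lambda>y. connection_form G y w z) (at x) v
       + connection_form G x v (connection_form G x w z))
    - (frechet_derivative (\<lambda>y. connection_form G y v z) (at x) w
       + connection_form G x w (connection_form G x v z))"
proof -
  \<comment> \<open>For constant fields the Lie bracket is 0, so the third term of the curvature is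
    the covariant derivative along the zero vector.\<close>
  have "connection_form G x 0 z = 0"
    by (simp add: connection_form_def vec_eq_iff)
  then show ?thesis
    unfolding curvature_tensor_def curvature_operator_def nabla_def lie_bracket_def by simp
qed

text \<open>After lowering, the curvature consists of second derivatives of \<open>G\<close> and
  products of connection forms. The products are preserved under exchange of \<open>w\<close> and
  \<open>z\<close> because the connection is torsion free and \<open>G x\<close> symmetric; the
  second derivatives match by Schwarz's theorem.\<close>

lemma curvature_symmetric:
  assumes x: "x \<in> S"
  shows "curvature_tensor G x v w v \<bullet> (G x *v z) = curvature_tensor G x v z v \<bullet> (G x *v w)"
proof -
  note G = symmetric_matrix_inner[OF sym[OF x]]
  note D2 = symmetric_matrix_inner[OF transpose_D2[OF x]]
  have "connection_form G x v z \<bullet> (G x *v connection_form G x w v)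
      = connection_form G x v w \<bullet> (G x *v connection_form G x z v)"
    using G[of "connection_form G x v z"] connection_form_commute[OF x] by metis
  moreover have "connection_form G x w z = connection_form G x z w"
    by (rule connection_form_commute[OF x])
  moreover have "D2 x v w = D2 x w v" "D2 x v z = D2 x z v" "D2 x w z = D2 x z w"
    by (rule D2_commute[OF x])+
  moreover have "w \<bullet> (D2 x v v *v z) = z \<bullet> (D2 x v v *v w)"
    "w \<bullet> (D2 x z v *v v) = v \<bullet> (D2 x z v *v w)"
    "z \<bullet> (D2 x w v *v v) = v \<bullet> (D2 x w v *v z)"
    by (rule D2)+
  ultimately show ?thesis
    unfolding curvature_tensor_eq[OF x] inner_diff_left derivative_connection_form_lower[OF x]
    by (simp add: diff_divide_distrib add_divide_distrib)
qed

end

subsection \<open>The parallel frame along iterates\<close>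

lemma positive_definite_invertible:
  assumes "positive_definite M"
  shows "invertible M"
proof -
  have "v = 0" if "M *v v = 0" for v
    using assms that unfolding positive_definite_def by (metis inner_zero_right less_irrefl)
  then show ?thesis
    by (meson invertible_left_inverse matrix_left_invertible_ker)
qed

lemma lorentz_signature_invertible:
  assumes "lorentz_signature M"
  shows "invertible M"
proof -
  obtain P :: "real ^ 'a ^ 'a" and k where
    eq: "transpose P ** M ** P = (\<chi> i j. if i = j then (if i = k then -1 else 1) else 0)" (is "_ = ?D")
    using assms unfolding lorentz_signature_def by blast
  have "det ?D = (\<Prod>i\<in>UNIV. ?D $ i $ i)"
    by (rule det_diagonal) simp
  then have "det ?D \<noteq> 0" by simp
  then have "det M \<noteq> 0"
    unfolding eq[symmetric] det_mul by simp
  then show ?thesis by (simp add: invertible_det_nz)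
qed

text \<open>A local statement: the functions and the sets are translates of each other only on
  \<open>I\<close>. This fits iterates, which are translates of the original curve within a single
  period.\<close>

lemma has_vector_derivative_shift:
  fixes g :: "real \<Rightarrow> 'a::real_normed_vector"
  assumes "open I" "t \<in> I" "t \<in> S"
    and S: "\<And>s. s \<in> I \<Longrightarrow> s \<in> S \<longleftrightarrow> s - a \<in> S'"
    and f: "\<And>s. s \<in> I \<Longrightarrow> f s = g (s - a)"
    and g: "(g has_vector_derivative D) (at (t - a) within S')"
  shows "(f has_vector_derivative D) (at t within S)"
proof -
  have "(g has_vector_derivative D) (at (t - a) within (\<lambda>s. s - a) ` (S \<inter> I))"
    using S by (intro has_vector_derivative_within_subset[OF g]) auto
  moreover have "((\<lambda>s. s - a) has_vector_derivative 1) (at t within S \<inter> I)"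
    by (auto intro!: derivative_eq_intros)
  ultimately have "(g \<circ> (\<lambda>s. s - a) has_vector_derivative 1 *\<^sub>R D) (at t within S \<inter> I)"
    by (intro vector_diff_chain_within)
  then have "(f has_vector_derivative D) (at t within S \<inter> I)"
    using assms(2,3) f by (intro has_vector_derivative_transform[where g = f and f = "g \<circ> (\<lambda>s. s - a)"]) auto
  moreover have "at t within S \<inter> I = at t within S"
    using assms(1,2) by (intro at_within_nhd[of t I]) auto
  ultimately show ?thesis by simp
qed

lemma vector_derivative_shift:
  fixes g :: "real \<Rightarrow> 'a::real_normed_vector"
  assumes "open I" "t \<in> I" "t \<in> S"
    and S: "\<And>s. s \<in> I \<Longrightarrow> s \<in> S \<longleftrightarrow> s - a \<in> S'"
    and f: "\<And>s. s \<in> I \<Longrightarrow> f s = g (s - a)"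
  shows "vector_derivative f (at t within S) = vector_derivative g (at (t - a) within S')"
proof -
  \<comment> \<open>\<open>vector_derivative\<close> chooses some derivative. Equivalence for every
    \<open>D\<close> makes the two choices equal, even where no derivative exists.\<close>
  have "(f has_vector_derivative D) (at t within S) \<longleftrightarrow> (g has_vector_derivative D) (at (t - a) within S')" for D
  proof
    assume D: "(f has_vector_derivative D) (at t within S)"
    have "open ((\<lambda>s. - a + s) ` I)" by (rule open_translation[OF assms(1)])
    then show "(g has_vector_derivative D) (at (t - a) within S')"
      by (rule has_vector_derivative_shift[where a = "- a" and S' = S and g = f])
        (use assms D in auto)
  next
    assume D: "(g has_vector_derivative D) (at (t - a) within S')"
    show "(f has_vector_derivative D) (at t within S)"
      by (rule has_vector_derivative_shift[where I = I and a = a and S' = S' and g = g])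
        (use assms D in auto)
  qed
  then show ?thesis by (simp add: vector_derivative_def)
qed

lemma matrix_pow_0 [simp]: "matrix_pow A 0 = mat 1"
  and matrix_pow_Suc: "matrix_pow A (Suc k) = A ** matrix_pow A k"
  by (simp_all add: matrix_pow_def)

lemma orthogonal_matrix_pow:
  "orthogonal_matrix A \<Longrightarrow> orthogonal_matrix (matrix_pow A k)"
  by (induction k) (simp_all add: matrix_pow_Suc orthogonal_matrix_mul orthogonal_matrix_id)

lemma inner_sum_sum_scaleR:
  fixes M :: "real ^ 'd ^ 'd"
  shows "(\<Sum>p\<in>I. a p *\<^sub>R v p) \<bullet> (M *v (\<Sum>q\<in>J. b q *\<^sub>R w q)) = (\<Sum>p\<in>I. \<Sum>q\<in>J. a p * b q * (v p \<bullet> (M *v w q)))"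
proof -
  have "M *v (\<Sum>q\<in>J. b q *\<^sub>R w q) = (\<Sum>q\<in>J. b q *\<^sub>R (M *v w q))"
    by (simp add: linear_sum[OF matrix_vector_mul_linear] matrix_vector_mult_scaleR)
  then show ?thesis
    by (simp add: inner_sum_left inner_sum_right sum_distrib_left mult.assoc mult.left_commute[of "b _"])
      (rule sum.swap)
qed

text \<open>The common ground of both signatures: invertible Gram matrices.\<close>

locale pseudo_riemannian_manifold =
  fixes X :: "'m topology" and \<A> :: "('m, 'd::finite) chart set" and g :: "('m, 'd) metric"
  assumes manifold: "smooth_manifold X \<A>"
    and tensor: "symmetric_tensor_field \<A> g"
    and invertible_metric: "c \<in> \<A> \<Longrightarrow> x \<in> snd c ` fst c \<Longrightarrow> invertible (g c x)"
begin

lemma chart_at_in: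
  assumes "p \<in> topspace X"
  shows "chart_at \<A> p \<in> \<A>" "p \<in> fst (chart_at \<A> p)"
proof -
  have "\<exists>c. c \<in> \<A> \<and> p \<in> fst c"
    using assms manifold unfolding smooth_manifold_def by (metis UN_E)
  from someI_ex[OF this] show "chart_at \<A> p \<in> \<A>" "p \<in> fst (chart_at \<A> p)"
    by (simp_all add: chart_at_def)
qed

lemma metric_on_chart:
  assumes "c \<in> \<A>"
  shows "metric_on_open_set (g c) (snd c ` fst c)"
proof
  show "open (snd c ` fst c)"
    using assms manifold unfolding smooth_manifold_def is_chart_def by blast
  show "smooth_on (snd c ` fst c) (g c)" "\<And>x. x \<in> snd c ` fst c \<Longrightarrow> transpose (g c x) = g c x"
    using assms tensor unfolding symmetric_tensor_field_def by blast+
qed (rule invertible_metric[OF assms])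

lemma curvature_at_symmetric:
  assumes "p \<in> topspace X"
  shows "curvature_at \<A> g p v w v z = curvature_at \<A> g p v z v w"
proof -
  interpret metric_on_open_set "g (chart_at \<A> p)" "snd (chart_at \<A> p) ` fst (chart_at \<A> p)"
    using assms by (intro metric_on_chart chart_at_in)
  show ?thesis
    unfolding curvature_at_def Let_def by (rule curvature_symmetric) (use chart_at_in[OF assms] in blast)
qed

lemma curvature_at_sum_right:
  "curvature_at \<A> g p v w v (\<lambda>c. \<Sum>q\<in>J. b q *\<^sub>R z q c) = (\<Sum>q\<in>J. b q * curvature_at \<A> g p v w v (z q))"
  by (simp add: curvature_at_def Let_def linear_sum[OF matrix_vector_mul_linear]
      matrix_vector_mult_scaleR inner_sum_right)

text \<open>Linearity in the last argument is immediate, as it enters through the inner product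
  alone; symmetry carries it over to the second argument.\<close>

lemma curvature_at_sum_sum:
  assumes "p \<in> topspace X"
  shows "curvature_at \<A> g p v (\<lambda>c. \<Sum>q\<in>I. a q *\<^sub>R w q c) v (\<lambda>c. \<Sum>q\<in>J. b q *\<^sub>R z q c)
    = (\<Sum>p'\<in>I. \<Sum>q\<in>J. a p' * b q * curvature_at \<A> g p v (w p') v (z q))"
proof -
  have "curvature_at \<A> g p v (\<lambda>c. \<Sum>q\<in>I. a q *\<^sub>R w q c) v (\<lambda>c. \<Sum>q\<in>J. b q *\<^sub>R z q c)
      = (\<Sum>q\<in>J. b q * curvature_at \<A> g p v (z q) v (\<lambda>c. \<Sum>q\<in>I. a q *\<^sub>R w q c))"
    by (simp add: curvature_at_sum_right curvature_at_symmetric[OF assms, of v "\<lambda>c. \<Sum>q\<in>I. a q *\<^sub>R w q c"])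
  also have "\<dots> = (\<Sum>q\<in>J. \<Sum>p'\<in>I. a p' * b q * curvature_at \<A> g p v (w p') v (z q))"
    unfolding curvature_at_sum_right sum_distrib_left
    by (intro sum.cong refl) (simp add: curvature_at_symmetric[OF assms, of v "w _"])
  also have "\<dots> = (\<Sum>p'\<in>I. \<Sum>q\<in>J. a p' * b q * curvature_at \<A> g p v (w p') v (z q))"
    by (rule sum.swap)
  finally show ?thesis .
qed

lemma transpose_curvature_matrix:
  assumes "\<gamma> t \<in> topspace X"
  shows "transpose (curvature_matrix \<A> g T \<gamma> e t) = curvature_matrix \<A> g T \<gamma> e t"
  using curvature_at_symmetric[OF assms]
  by (simp add: transpose_def curvature_matrix_def vec_eq_iff)

text \<open>The frame is orthonormal at time 0 and at time \<open>T\<close>, for the same inner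
  product since the curve is closed. Expanding the second frame in the first gives the orthogonality
  relations.\<close>

lemma orthogonal_holonomy:
  assumes "T > 0" "\<gamma> 0 = \<gamma> T" "\<gamma> 0 \<in> topspace X"
    and frame: "normal_parallel_frame \<A> g T \<gamma> e"
    and hol: "holonomy_matrix \<A> T \<gamma> e A"
  shows "orthogonal_matrix A"
proof -
  let ?c = "chart_at \<A> (\<gamma> 0)"
  have eT: "e j T ?c = (\<Sum>i\<in>UNIV. A $ i $ j *\<^sub>R e i 0 ?c)" for j
    using hol chart_at_in[OF assms(3)] unfolding holonomy_matrix_def by blast
  have m0: "e i 0 ?c \<bullet> (g ?c (snd ?c (\<gamma> 0)) *v e j 0 ?c) = (if i = j then 1 else 0)" for i j
    using frame \<open>T > 0\<close> unfolding normal_parallel_frame_def metric_at_def Let_def by force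
  have mT: "e i T ?c \<bullet> (g ?c (snd ?c (\<gamma> 0)) *v e j T ?c) = (if i = j then 1 else 0)" for i j
    using frame \<open>T > 0\<close> unfolding normal_parallel_frame_def metric_at_def Let_def assms(2) by force
  have "transpose A ** A = mat 1"
    using mT unfolding eT inner_sum_sum_scaleR m0
    by (simp add: matrix_matrix_mult_def transpose_def mat_def vec_eq_iff if_distrib cong: if_cong)
  then show ?thesis by (simp add: orthogonal_matrix)
qed

text \<open>Inside one period the iterate is a translate of the curve and its frame is
  \<open>e\<close> times a constant matrix, so bilinearity of the curvature applies. At interior
  times a whole neighbourhood stays in the same period, so velocities agree as well.\<close>

lemma curvature_matrix_iterate:
  assumes "T > 0" "k < m" and t: "real k * T < t" "t < real (Suc k) * T"
    and top: "\<gamma> (t - real k * T) \<in> topspace X"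
  shows "curvature_matrix \<A> g (real m * T) (iterate_curve T \<gamma>) (iterate_frame T A e) t =
    transpose (matrix_pow A k) ** curvature_matrix \<A> g T \<gamma> e (t - real k * T) ** matrix_pow A k"
proof -
  let ?I = "{real k * T <..< real (Suc k) * T}"
  have fl: "\<lfloor>s / T\<rfloor> = int k" if "s \<in> ?I" for s
    using that \<open>T > 0\<close> by (intro floor_unique) (auto simp: field_simps)
  have it: "iterate_curve T \<gamma> s = \<gamma> (s - real k * T)" if "s \<in> ?I" for s
    using fl[OF that] by (simp add: iterate_curve_def)
  have tI: "t \<in> ?I" using t by simp
  let ?p = "\<gamma> (t - real k * T)"
  have times: "s \<in> chart_times (real m * T) (iterate_curve T \<gamma>) c \<longleftrightarrow> s - real k * T \<in> chart_times T \<gamma> c"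
    if "s \<in> ?I" for s c
  proof -
    have "real (Suc k) * T \<le> real m * T" using \<open>k < m\<close> \<open>T > 0\<close> by (intro mult_right_mono) auto
    moreover have "0 \<le> real k * T" using \<open>T > 0\<close> by simp
    ultimately have "0 \<le> s" "s \<le> real m * T" "0 \<le> s - real k * T" "s - real k * T \<le> T"
      using that by (simp_all add: distrib_right del: zero_le_mult_iff mult_nonneg_nonneg)
    then show ?thesis by (simp add: chart_times_def it[OF that])
  qed
  let ?c = "chart_at \<A> ?p"
  \<comment> \<open>\<open>curvature_at\<close> reads tangent vectors in this chart only, so
    equality there suffices.\<close>
  have vel: "velocity (real m * T) (iterate_curve T \<gamma>) t ?c = velocity T \<gamma> (t - real k * T) ?c"
    unfolding velocity_def
  proof (rule vector_derivative_shift[of ?I])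
    have "t - real k * T \<in> chart_times T \<gamma> ?c"
      using tI chart_at_in[OF top] by (auto simp: chart_times_def algebra_simps)
    then show "t \<in> chart_times (real m * T) (iterate_curve T \<gamma>) ?c"
      by (simp add: times[OF tI])
    show "(snd ?c \<circ> iterate_curve T \<gamma>) s = (snd ?c \<circ> \<gamma>) (s - real k * T)" if "s \<in> ?I" for s
      by (simp add: it[OF that])
  qed (simp, rule tI, rule times)
  have "curvature_matrix \<A> g (real m * T) (iterate_curve T \<gamma>) (iterate_frame T A e) t $ i $ j =
      (\<Sum>p\<in>UNIV. \<Sum>q\<in>UNIV. matrix_pow A k $ p $ i * matrix_pow A k $ q $ j *
        curvature_matrix \<A> g T \<gamma> e (t - real k * T) $ p $ q)" for i j
  proof -
    have "curvature_matrix \<A> g (real m * T) (iterate_curve T \<gamma>) (iterate_frame T A e) t $ i $ j =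
       curvature_at \<A> g ?p (velocity T \<gamma> (t - real k * T)) (iterate_frame T A e i t)
         (velocity T \<gamma> (t - real k * T)) (iterate_frame T A e j t)"
      by (simp add: curvature_matrix_def it[OF tI] curvature_at_def Let_def vel)
    then show ?thesis
      by (simp add: iterate_frame_def fl[OF tI] curvature_at_sum_sum[OF top] curvature_matrix_def)
  qed
  moreover have "(transpose (matrix_pow A k) ** C ** matrix_pow A k) $ i $ j =
      (\<Sum>p\<in>UNIV. \<Sum>q\<in>UNIV. matrix_pow A k $ p $ i * matrix_pow A k $ q $ j * C $ p $ q)" for C i j
    unfolding matrix_matrix_mult_def transpose_def vec_lambda_beta sum_distrib_right
    by (subst sum.swap) (simp add: ac_simps)
  ultimately show ?thesis
    unfolding vec_eq_iff by presburger
qed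

end

subsection \<open>The symplectic form and the Krein form\<close>

text \<open>In the first-order system the lower half is a solution of the Jacobi equation and the
  upper half is its derivative.\<close>

definition upper :: "'a ^ ('n::finite + 'n) \<Rightarrow> 'a ^ 'n" where "upper v = (\<chi> i. v $ Inl i)"
definition lower :: "'a ^ ('n::finite + 'n) \<Rightarrow> 'a ^ 'n" where "lower v = (\<chi> i. v $ Inr i)"

lemma upper_lower_linear:
  "bounded_linear (upper :: real ^ ('n::finite + 'n) \<Rightarrow> _)" "bounded_linear (lower :: real ^ ('n::finite + 'n) \<Rightarrow> _)"
  by (intro linear_conv_bounded_linear[THEN iffD1] linearI; simp add: upper_def lower_def vec_eq_iff)+

lemma sum_UNIV_Plus:
  fixes f :: "'a::finite + 'b::finite \<Rightarrow> 'c::comm_monoid_add"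
  shows "(\<Sum>i\<in>UNIV. f i) = (\<Sum>i\<in>UNIV. f (Inl i)) + (\<Sum>i\<in>UNIV. f (Inr i))"
  by (subst UNIV_Plus_UNIV[symmetric], subst sum.Plus) (simp_all add: o_def)

lemma upper_lower_block_matrix:
  "upper (block_matrix A B C D *v v) = A *v upper v + B *v lower v"
  "lower (block_matrix A B C D *v v) = C *v upper v + D *v lower v"
  by (simp_all add: upper_def lower_def block_matrix_def matrix_vector_mult_def vec_eq_iff sum_UNIV_Plus)

lemma inner_upper_lower: "v \<bullet> w = upper v \<bullet> upper w + lower v \<bullet> lower w"
  by (simp add: inner_vec_def upper_def lower_def sum_UNIV_Plus)

definition omega :: "real ^ ('n::finite + 'n) \<Rightarrow> real ^ ('n + 'n) \<Rightarrow> real" where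
  "omega v w = v \<bullet> (J_matrix *v w)"

lemma omega_eq:
  fixes v w :: "real ^ ('n::finite + 'n)"
  shows "omega v w = lower v \<bullet> upper w - lower w \<bullet> upper v"
proof -
  have "(- M) *v x = - (M *v x)" for M :: "real ^ 'n ^ 'n" and x
    by (simp add: matrix_vector_mult_def vec_eq_iff sum_negf)
  then show ?thesis
    unfolding omega_def inner_upper_lower[of v] J_matrix_def upper_lower_block_matrix
    by (simp add: inner_commute)
qed

lemma omega_skew: "omega v w = - omega w v"
  by (simp add: omega_eq inner_commute)

lemma omega_linear:
  "omega (a + b) c = omega a c + omega b c" "omega a (b + c) = omega a b + omega a c"
  "omega (a - b) c = omega a c - omega b c" "omega a (b - c) = omega a b - omega a c"
  "omega (r *\<^sub>R a) b = r * omega a b" "omega a (r *\<^sub>R b) = r * omega a b"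
  by (simp_all add: omega_def inner_add_left inner_add_right inner_diff_left inner_diff_right
      matrix_vector_right_distrib matrix_vector_mult_diff_distrib matrix_vector_mult_scaleR)

lemma symplectic_iff_omega:
  fixes S :: "real ^ ('n::finite + 'n) ^ ('n + 'n)"
  shows "symplectic S \<longleftrightarrow> (\<forall>v w. omega (S *v v) (S *v w) = omega v w)"
proof -
  have "omega (S *v v) (S *v w) = v \<bullet> ((transpose S ** J_matrix ** S) *v w)" for v w
    by (simp only: omega_def inner_matrix_vector_transpose matrix_vector_mul_assoc matrix_mul_assoc)
  moreover have "M = N" if "\<And>v w. v \<bullet> (M *v w) = v \<bullet> (N *v w)" for M N :: "real ^ ('n + 'n) ^ ('n + 'n)"
    using that vector_eq_ldot unfolding matrix_eq by blast
  ultimately show ?thesis unfolding symplectic_def omega_def by auto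
qed

section \<open>Complex vectors and the Krein form\<close>

definition re_vec :: "complex ^ 'k \<Rightarrow> real ^ 'k" where "re_vec z = (\<chi> i. Re (z $ i))"
definition im_vec :: "complex ^ 'k \<Rightarrow> real ^ 'k" where "im_vec z = (\<chi> i. Im (z $ i))"

lemma re_im_vec_add:
  "re_vec (z + w) = re_vec z + re_vec w" "im_vec (z + w) = im_vec z + im_vec w"
  by (simp_all add: re_vec_def im_vec_def vec_eq_iff)

lemma re_im_vec_mult:
  "re_vec (\<mu> *s z) = Re \<mu> *\<^sub>R re_vec z + (- Im \<mu>) *\<^sub>R im_vec z"
  "im_vec (\<mu> *s z) = Re \<mu> *\<^sub>R im_vec z + Im \<mu> *\<^sub>R re_vec z"
  by (simp_all add: re_vec_def im_vec_def vec_eq_iff)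

lemma re_im_vec_matrix:
  "re_vec (map_matrix complex_of_real S *v z) = S *v re_vec z"
  "im_vec (map_matrix complex_of_real S *v z) = S *v im_vec z"
  by (simp_all add: re_vec_def im_vec_def vec_eq_iff matrix_vector_mult_def)

text \<open>The sesquilinear extension of \<open>omega\<close>, antilinear in the first argument. It
  is skew-Hermitian, hence the Hermitian Krein form up to a factor \<open>\<i>\<close>.\<close>

definition krein :: "complex ^ ('n::finite + 'n) \<Rightarrow> complex ^ ('n + 'n) \<Rightarrow> complex" where
  "krein z w = Complex (omega (re_vec z) (re_vec w) + omega (im_vec z) (im_vec w))
     (omega (re_vec z) (im_vec w) - omega (im_vec z) (re_vec w))"

lemma krein_add:
  "krein (z + z') w = krein z w + krein z' w" "krein z (w + w') = krein z w + krein z w'"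
  by (simp_all add: krein_def re_im_vec_add omega_linear complex_eq_iff)

lemma krein_mult:
  "krein (\<mu> *s z) w = cnj \<mu> * krein z w" "krein z (\<mu> *s w) = \<mu> * krein z w"
  by (simp_all add: krein_def re_im_vec_mult omega_linear complex_eq_iff algebra_simps)

lemma krein_sum:
  assumes "finite I"
  shows "krein (\<Sum>i\<in>I. x i *s z i) w = (\<Sum>i\<in>I. cnj (x i) * krein (z i) w)"
    and "krein w (\<Sum>i\<in>I. x i *s z i) = (\<Sum>i\<in>I. x i * krein w (z i))"
proof -
  have "krein 0 w = 0" "krein w 0 = 0"
    using krein_mult(1)[of 0 0 w] krein_mult(2)[of w 0 0] by simp_all
  with assms show "krein (\<Sum>i\<in>I. x i *s z i) w = (\<Sum>i\<in>I. cnj (x i) * krein (z i) w)"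
    by (induction I rule: finite_induct) (simp_all add: krein_add krein_mult)
  show "krein w (\<Sum>i\<in>I. x i *s z i) = (\<Sum>i\<in>I. x i * krein w (z i))"
    using assms \<open>krein w 0 = 0\<close>
    by (induction I rule: finite_induct) (simp_all add: krein_add krein_mult)
qed

lemma krein_symplectic:
  assumes "symplectic S"
  shows "krein (map_matrix complex_of_real S *v z) (map_matrix complex_of_real S *v w) = krein z w"
  using assms by (simp add: krein_def re_im_vec_matrix symplectic_iff_omega)

text \<open>On the diagonal the form is purely imaginary, with imaginary part twice
  \<open>omega (re_vec z) (im_vec z)\<close>.\<close>

lemma krein_self_eq_0: "krein z z = 0 \<longleftrightarrow> omega (re_vec z) (im_vec z) = 0"
  using omega_skew[of "re_vec z" "im_vec z"] omega_skew[of "re_vec z" "re_vec z"] omega_skew[of "im_vec z" "im_vec z"]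
  by (simp add: krein_def complex_eq_iff)

text \<open>The vectors \<open>z + w\<close> and \<open>z + \<i> *s w\<close> give the sum and the
  difference of \<open>krein z w\<close> and \<open>krein w z\<close>.\<close>

lemma krein_polarization:
  assumes "krein z z = 0" "krein w w = 0" "krein (z + w) (z + w) = 0" "krein (z + \<i> *s w) (z + \<i> *s w) = 0"
  shows "krein z w = 0"
proof -
  have "krein z w + krein w z = 0" "\<i> * krein z w - \<i> * krein w z = 0"
    using assms by (simp_all add: krein_add krein_mult algebra_simps)
  then have "2 * krein z w = 0" by (simp add: right_diff_distrib[symmetric])
  then show ?thesis by simp
qed

lemma not_linearly_stable_if_isotropic_eigenvectors:
  fixes S :: "real ^ ('n::finite + 'n) ^ ('n + 'n)"
  assumes S: "symplectic S"
    and iso: "\<And>\<mu> z. cmod \<mu> = 1 \<Longrightarrow> map_matrix complex_of_real S *v z = \<mu> *s z \<Longrightarrow> krein z z = 0"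
  shows "\<not> linearly_stable S"
proof
  assume stable: "linearly_stable S"
  let ?S = "map_matrix complex_of_real S"
  obtain P D :: "complex ^ ('n + 'n) ^ ('n + 'n)" where P: "invertible P"
    and D: "\<And>i j. i \<noteq> j \<Longrightarrow> D $ i $ j = 0" and eq: "?S = P ** D ** matrix_inv P"
    using stable unfolding linearly_stable_def diagonalizable_over_complex_def by blast
  have Pi: "matrix_inv P ** P = mat 1" "P ** matrix_inv P = mat 1"
    using matrix_inv_inverse[OF P] by simp_all
  have "?S ** P = P ** D"
    by (simp add: eq matrix_mul_assoc[symmetric] Pi)
  then have SP: "(\<Sum>k\<in>UNIV. ?S $ i $ k * P $ k $ j) = (\<Sum>k\<in>UNIV. P $ i $ k * D $ k $ j)" for i j
    by (simp add: matrix_matrix_mult_def vec_eq_iff)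
  have "(\<Sum>k\<in>UNIV. P $ i $ k * D $ k $ j) = (\<Sum>k\<in>UNIV. if k = j then P $ i $ j * D $ j $ j else 0)" for i j
    by (rule sum.cong[OF refl]) (simp add: D)
  with SP have eig: "?S *v column j P = D $ j $ j *s column j P" for j
    by (simp add: vec_eq_iff matrix_vector_mult_def column_def mult.commute)
  have nz: "column j P \<noteq> 0" for j
  proof
    assume "column j P = 0"
    moreover have "P *v axis j 1 = column j P"
      by (simp add: vec_eq_iff matrix_vector_mult_def column_def axis_def if_distrib cong: if_cong)
    ultimately have "matrix_inv P *v (P *v axis j 1) = 0" by simp
    then have "axis j (1::complex) = 0" by (simp add: matrix_vector_mul_assoc Pi)
    then show False by (simp add: axis_eq_0_iff)
  qed
  have unit: "cmod (D $ j $ j) = 1" for j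
    using stable nz eig unfolding linearly_stable_def by blast
  \<comment> \<open>For equal eigenvalues, combinations of the two columns are again eigenvectors,
    hence isotropic, and polarization applies. For different ones, invariance under \<open>S\<close>
    multiplies the form by a factor other than 1.\<close>
  have cols: "krein (column i P) (column j P) = 0" for i j
  proof (cases "D $ i $ i = D $ j $ j")
    case True
    let ?\<mu> = "D $ j $ j"
    have lin: "?S *v (column i P + c *s column j P) = ?\<mu> *s (column i P + c *s column j P)" for c
      using eig[of i] eig[of j] True
      by (simp add: matrix_vector_right_distrib vector_scalar_commute vector_add_ldistrib vector_smult_assoc mult.commute)
    show ?thesis
      using krein_polarization[OF iso[OF unit eig] iso[OF unit eig], of i j] iso[OF unit lin[of 1]] iso[OF unit lin[of \<i>]]
      by simp
  next
    case False
    have "krein (column i P) (column j P) = D $ j $ j * cnj (D $ i $ i) * krein (column i P) (column j P)"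
      using krein_symplectic[OF S, of "column i P" "column j P"] by (simp add: eig krein_mult)
    \<comment> \<open>On the unit circle the conjugate is the inverse, so the factor is 1 only if
      the eigenvalues coincide.\<close>
    moreover have "D $ j $ j * cnj (D $ i $ i) \<noteq> 1"
    proof
      assume "D $ j $ j * cnj (D $ i $ i) = 1"
      then have "D $ i $ i * cnj (D $ i $ i) * D $ j $ j = D $ i $ i" by (simp add: mult.assoc mult.commute[of "cnj _"])
      moreover have "D $ i $ i * cnj (D $ i $ i) = 1"
        using unit[of i] by (simp add: complex_norm_square[symmetric])
      ultimately show False using False by simp
    qed
    ultimately show ?thesis by simp
  qed
  have zero: "krein z w = 0" for z w :: "complex ^ ('n + 'n)"
  proof -
    have span: "v = (\<Sum>i\<in>UNIV. (matrix_inv P *v v) $ i *s column i P)" for v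
      by (simp add: matrix_mult_sum[symmetric] matrix_vector_mul_assoc Pi)
    have c: "krein (column i P) w = 0" for i
      by (subst span) (simp add: krein_sum cols)
    show ?thesis
      by (subst span[of z]) (simp add: krein_sum c)
  qed
  have om: "omega a b = 0" for a b :: "real ^ ('n + 'n)"
    using zero[of "\<chi> i. of_real (a $ i)" "\<chi> i. of_real (b $ i)"]
    by (simp add: krein_def re_vec_def im_vec_def complex_eq_iff omega_def zero_vec_def[symmetric])
  \<comment> \<open>Types are inhabited; this is where n is at least 1. A conjugate pair of axis
    vectors then shows that \<open>omega\<close> is not zero.\<close>
  obtain k :: 'n where True by blast
  have "omega (axis (Inr k) 1) (axis (Inl k) 1) = 1"
    unfolding omega_eq
    by (simp add: upper_def lower_def axis_def inner_vec_def if_distrib cong: if_cong)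
  with om show False by simp
qed

subsection \<open>The index form of a rotated solution\<close>

text \<open>\<open>index_form\<close> uses the classical two-sided derivative, whose value is
  uncontrolled at the points of \<open>F\<close> and at both end points. These form a negligible
  set.\<close>

lemma index_form_eq:
  assumes "finite F"
    and u: "\<And>t. t \<in> {0<..<L} - F \<Longrightarrow> (u has_vector_derivative w t) (at t)"
    and I: "((\<lambda>t. w t \<bullet> w t + (R t *v u t) \<bullet> u t) has_integral I) {0..L}"
  shows "index_form L R u u = I"
proof -
  have "((\<lambda>t. vector_derivative u (at t) \<bullet> vector_derivative u (at t) + (R t *v u t) \<bullet> u t)
      has_integral I) {0..L}"
  proof (rule has_integral_spike[OF _ _ I])
    show "negligible (insert 0 (insert L F))"
      using assms(1) by (intro negligible_finite) simp
    fix t assume "t \<in> {0..L} - insert 0 (insert L F)"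
    then have "vector_derivative u (at t) = w t"
      by (intro vector_derivative_at u) auto
    then show "vector_derivative u (at t) \<bullet> vector_derivative u (at t) + (R t *v u t) \<bullet> u t
      = w t \<bullet> w t + (R t *v u t) \<bullet> u t" by simp
  qed
  then show ?thesis
    unfolding index_form_def by (rule integral_unique)
qed

text \<open>If \<open>I\<close> were negative, \<open>u\<close> alone would span a one-dimensional
  negative subspace.\<close>

lemma morse_index_zero_imp_nonneg:
  assumes idx: "morse_index L A R = 0" and E: "u \<in> E_space L A" and F: "finite F"
    and u: "\<And>t. t \<in> {0<..<L} - F \<Longrightarrow> (u has_vector_derivative w t) (at t)"
    and I: "((\<lambda>t. w t \<bullet> w t + (R t *v u t) \<bullet> u t) has_integral I) {0..L}"
  shows "0 \<le> I"
proof (rule ccontr)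
  assume "\<not> 0 \<le> I"
  \<comment> \<open>Linear independence of the single function \<open>u\<close>: if it vanished on
    the interval, so would its derivative off \<open>F\<close>, and \<open>I\<close> would be
    0.\<close>
  have nz: "\<exists>t\<in>{0..L}. u t \<noteq> 0"
  proof (rule ccontr)
    assume "\<not> (\<exists>t\<in>{0..L}. u t \<noteq> 0)"
    then have z: "u t = 0" if "t \<in> {0..L}" for t using that by blast
    have w: "w t = 0" if t: "t \<in> {0<..<L} - F" for t
    proof -
      have "((\<lambda>_. 0) has_vector_derivative w t) (at t)"
        by (rule has_vector_derivative_transform_within_open[OF u[OF t], of "{0<..<L}"])
          (use t z in auto)
      then show ?thesis using vector_derivative_unique_at has_vector_derivative_const by blast
    qed
    have "((\<lambda>t. 0) has_integral I) {0..L}"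
    proof (rule has_integral_spike[OF _ _ I])
      show "negligible (insert 0 (insert L F))"
        using F by (intro negligible_finite) simp
    qed (use w z in auto)
    then have "I = 0" by (simp add: has_integral_0_eq)
    with \<open>\<not> 0 \<le> I\<close> show False by simp
  qed
  have scaled: "index_form L R (\<lambda>t. c *\<^sub>R u t) (\<lambda>t. c *\<^sub>R u t) = c\<^sup>2 * I" for c
  proof (rule index_form_eq[OF F, of _ _ "\<lambda>t. c *\<^sub>R w t"])
    show "((\<lambda>t. c *\<^sub>R u t) has_vector_derivative c *\<^sub>R w t) (at t)" if "t \<in> {0<..<L} - F" for t
      using u[OF that] by (auto intro!: derivative_eq_intros)
    show "((\<lambda>t. c *\<^sub>R w t \<bullet> c *\<^sub>R w t + (R t *v c *\<^sub>R u t) \<bullet> c *\<^sub>R u t) has_integral c\<^sup>2 * I) {0..L}"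
      using has_integral_mult_right[OF I, of "c\<^sup>2"]
      by (simp add: matrix_vector_mult_scaleR power2_eq_square algebra_simps)
  qed
  have "negative_subspace_basis L A R 1 (\<lambda>_. u)"
    unfolding negative_subspace_basis_def Let_def
  proof (intro conjI allI impI)
    fix a :: "nat \<Rightarrow> real"
    show "a i = 0" if "\<forall>t\<in>{0..L}. (\<Sum>i<1. a i *\<^sub>R u t) = 0" "i < 1" for i
      using nz that by auto
    show "index_form L R (\<lambda>t. \<Sum>i<1. a i *\<^sub>R u t) (\<lambda>t. \<Sum>i<1. a i *\<^sub>R u t) < 0"
      if "\<exists>t\<in>{0..L}. (\<Sum>i<1. a i *\<^sub>R u t) \<noteq> 0"
      using that \<open>\<not> 0 \<le> I\<close> by (auto simp: scaled mult_pos_neg)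
  qed (use E in simp)
  then have "enat 1 \<le> morse_index L A R"
    unfolding morse_index_def by (intro Sup_upper) blast
  with idx show False by (simp add: zero_enat_def)
qed

text \<open>\<open>w\<close> is the required density: it is continuous, hence square integrable, and
  the fundamental theorem tolerates the finitely many points of \<open>F\<close> because
  \<open>u\<close> is continuous.\<close>

lemma W12_I:
  fixes u :: "real \<Rightarrow> real ^ 'n::finite"
  assumes "finite F" "continuous_on {0..L} u" and w: "continuous_on {0..L} w"
    and d: "\<And>t. t \<in> {0<..<L} - F \<Longrightarrow> (u has_vector_derivative w t) (at t)"
  shows "u \<in> W12 L"
proof -
  have "w \<in> borel_measurable (lebesgue_on {0..L})"
    using w by (intro continuous_imp_measurable_on_sets_lebesgue) auto
  moreover have "(\<lambda>t. (norm (w t))\<^sup>2) absolutely_integrable_on {0..L}"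
    using w by (intro absolutely_integrable_continuous_real continuous_intros)
  moreover have "u t = u 0 + integral {0..t} w" if t: "t \<in> {0..L}" for t
  proof -
    have "(w has_integral (u t - u 0)) {0..t}"
      using t d by (intro fundamental_theorem_of_calculus_interior_strong[OF assms(1)]
          continuous_on_subset[OF assms(2)]) auto
    then show ?thesis by (simp add: integral_unique)
  qed
  ultimately show ?thesis unfolding W12_def by blast
qed

text \<open>The test function is the real part \<open>u\<close> of \<open>cis (\<sigma> t) (p + \<i> q)\<close>; the choice of \<open>\<sigma>\<close> makes it periodic.
  With \<open>w\<close> its imaginary part and \<open>\<zeta>\<close> the real part of \<open>cis (\<sigma> t) (y + \<i> z)\<close>, the integrand of the
  index form is the derivative of \<open>u \<bullet> \<zeta>\<close> plus \<open>\<sigma>\<close> times the (constant) Wronskian plus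
  \<open>\<sigma>\<^sup>2 (w \<bullet> w)\<close>.\<close>

lemma twisted_solutions_index_form:
  fixes p q y z :: "real \<Rightarrow> real ^ 'n::finite" and R :: "real \<Rightarrow> real ^ 'n ^ 'n"
  assumes "L > 0" and F: "finite F"
    and cont: "continuous_on {0..L} p" "continuous_on {0..L} q"
      "continuous_on {0..L} y" "continuous_on {0..L} z"
    and p: "\<And>t. t \<in> {0<..<L} - F \<Longrightarrow> (p has_vector_derivative y t) (at t)"
    and q: "\<And>t. t \<in> {0<..<L} - F \<Longrightarrow> (q has_vector_derivative z t) (at t)"
    and y: "\<And>t. t \<in> {0<..<L} - F \<Longrightarrow> (y has_vector_derivative R t *v p t) (at t)"
    and z: "\<And>t. t \<in> {0<..<L} - F \<Longrightarrow> (z has_vector_derivative R t *v q t) (at t)"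
    and R: "\<And>t. t \<in> {0<..<L} - F \<Longrightarrow> transpose (R t) = R t"
    and B: "orthogonal_matrix B"
    and Bp: "B *v p L = cos \<alpha> *\<^sub>R p 0 - sin \<alpha> *\<^sub>R q 0" and Bq: "B *v q L = sin \<alpha> *\<^sub>R p 0 + cos \<alpha> *\<^sub>R q 0"
    and By: "B *v y L = cos \<alpha> *\<^sub>R y 0 - sin \<alpha> *\<^sub>R z 0" and Bz: "B *v z L = sin \<alpha> *\<^sub>R y 0 + cos \<alpha> *\<^sub>R z 0"
    and \<sigma>: "sin (\<sigma> * L + \<alpha>) = 0" "cos (\<sigma> * L + \<alpha>) = 1"
    and idx: "morse_index L B R = 0"
    and M: "\<And>t. t \<in> {0..L} \<Longrightarrow> norm (p t) + norm (q t) \<le> M"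
  shows "0 \<le> \<sigma> * (p 0 \<bullet> z 0 - q 0 \<bullet> y 0) + \<sigma>\<^sup>2 * M\<^sup>2"
proof -
  let ?W = "p 0 \<bullet> z 0 - q 0 \<bullet> y 0"
  define u where "u t = cos (\<sigma> * t) *\<^sub>R p t - sin (\<sigma> * t) *\<^sub>R q t" for t
  define w where "w t = sin (\<sigma> * t) *\<^sub>R p t + cos (\<sigma> * t) *\<^sub>R q t" for t
  define \<zeta> where "\<zeta> t = cos (\<sigma> * t) *\<^sub>R y t - sin (\<sigma> * t) *\<^sub>R z t" for t
  define \<eta> where "\<eta> t = sin (\<sigma> * t) *\<^sub>R y t + cos (\<sigma> * t) *\<^sub>R z t" for t
  have cos': "((\<lambda>t. cos (\<sigma> * t)) has_real_derivative - \<sigma> * sin (\<sigma> * t)) (at t)"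
    and sin': "((\<lambda>t. sin (\<sigma> * t)) has_real_derivative \<sigma> * cos (\<sigma> * t)) (at t)" for t
    by (auto intro!: derivative_eq_intros)
  have u': "(u has_vector_derivative \<zeta> t - \<sigma> *\<^sub>R w t) (at t)" if t: "t \<in> {0<..<L} - F" for t
    unfolding u_def w_def \<zeta>_def
    by (rule has_vector_derivative_eq_rhs[OF has_vector_derivative_diff[OF
          has_vector_derivative_scaleR[OF cos' p[OF t]] has_vector_derivative_scaleR[OF sin' q[OF t]]]])
      (simp add: algebra_simps)
  have \<zeta>': "(\<zeta> has_vector_derivative R t *v u t - \<sigma> *\<^sub>R \<eta> t) (at t)" if t: "t \<in> {0<..<L} - F" for t
    unfolding u_def \<eta>_def \<zeta>_def
    by (rule has_vector_derivative_eq_rhs[OF has_vector_derivative_diff[OF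
          has_vector_derivative_scaleR[OF cos' y[OF t]] has_vector_derivative_scaleR[OF sin' z[OF t]]]])
      (simp add: algebra_simps)
  have conts: "continuous_on {0..L} u" "continuous_on {0..L} w" "continuous_on {0..L} \<zeta>" "continuous_on {0..L} \<eta>"
    unfolding u_def w_def \<zeta>_def \<eta>_def by (intro continuous_intros cont)+
  \<comment> \<open>Constancy of the Wronskian uses the symmetry of \<open>R\<close>: its derivative
    is 0 off the finite set \<open>F\<close>.\<close>
  have wronski: "p t \<bullet> z t - q t \<bullet> y t = ?W" if t: "t \<in> {0..L}" for t
  proof -
    have "((\<lambda>t. 0) has_integral (p t \<bullet> z t - q t \<bullet> y t - ?W)) {0..t}"
    proof (rule fundamental_theorem_of_calculus_interior_strong[OF F])
      show "continuous_on {0..t} (\<lambda>t. p t \<bullet> z t - q t \<bullet> y t)"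
        using t by (intro continuous_on_subset[of "{0..L}" _ "{0..t}", OF continuous_on_diff]
            continuous_on_inner cont) auto
      fix s assume "s \<in> {0<..<t} - F"
      with t have s: "s \<in> {0<..<L} - F" by auto
      have sym: "p s \<bullet> (R s *v q s) = q s \<bullet> (R s *v p s)"
        by (rule symmetric_matrix_inner[OF R[OF s]])
      show "((\<lambda>t. p t \<bullet> z t - q t \<bullet> y t) has_vector_derivative 0) (at s)"
        by (rule has_vector_derivative_eq_rhs[OF has_vector_derivative_diff[OF
              bounded_bilinear.has_vector_derivative[OF bounded_bilinear_inner p[OF s] z[OF s]]
              bounded_bilinear.has_vector_derivative[OF bounded_bilinear_inner q[OF s] y[OF s]]]])
          (simp add: sym inner_commute)
    qed (use t in auto)
    then show ?thesis by (simp add: has_integral_0_eq)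
  qed
  have W: "u t \<bullet> \<eta> t - w t \<bullet> \<zeta> t = ?W" if t: "t \<in> {0..L}" for t
  proof -
    have "u t \<bullet> \<eta> t - w t \<bullet> \<zeta> t = ((sin (\<sigma> * t))\<^sup>2 + (cos (\<sigma> * t))\<^sup>2) * (p t \<bullet> z t - q t \<bullet> y t)"
      unfolding u_def w_def \<zeta>_def \<eta>_def
      by (simp only: inner_add_left inner_add_right inner_diff_left inner_diff_right
          inner_scaleR_left inner_scaleR_right) algebra
    then show ?thesis using wronski[OF t] by simp
  qed
  \<comment> \<open>Rotating by \<open>\<sigma> * L\<close> after the twist by \<alpha> is the
    identity, by the choice of \<sigma>. Hence both \<open>u\<close> and \<zeta> satisfy the
    boundary condition of \<open>B\<close>.\<close>
  have rot: "cos (\<sigma> * L) *\<^sub>R (cos \<alpha> *\<^sub>R a - sin \<alpha> *\<^sub>R b) - sin (\<sigma> * L) *\<^sub>R (sin \<alpha> *\<^sub>R a + cos \<alpha> *\<^sub>R b) = a" for a b :: "real ^ 'n"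
  proof -
    have "cos (\<sigma> * L) *\<^sub>R (cos \<alpha> *\<^sub>R a - sin \<alpha> *\<^sub>R b) - sin (\<sigma> * L) *\<^sub>R (sin \<alpha> *\<^sub>R a + cos \<alpha> *\<^sub>R b)
      = cos (\<sigma> * L + \<alpha>) *\<^sub>R a - sin (\<sigma> * L + \<alpha>) *\<^sub>R b"
      unfolding cos_add sin_add by (simp add: algebra_simps)
    with \<sigma> show ?thesis by simp
  qed
  have Bu: "B *v u L = u 0"
    unfolding u_def by (simp add: matrix_vector_mult_diff_distrib matrix_vector_mult_scaleR Bp Bq rot)
  have B\<zeta>: "B *v \<zeta> L = \<zeta> 0"
    unfolding \<zeta>_def by (simp add: matrix_vector_mult_diff_distrib matrix_vector_mult_scaleR By Bz rot)
  have E: "u \<in> E_space L B"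
    using W12_I[OF F conts(1) continuous_on_diff[OF conts(3) continuous_on_scaleR[OF continuous_on_const conts(2)]] u']
    by (simp add: E_space_def Bu)
  have 1: "((\<lambda>t. u t \<bullet> (R t *v u t - \<sigma> *\<^sub>R \<eta> t) + (\<zeta> t - \<sigma> *\<^sub>R w t) \<bullet> \<zeta> t) has_integral (u L \<bullet> \<zeta> L - u 0 \<bullet> \<zeta> 0)) {0..L}"
    using \<open>L > 0\<close>
    by (intro fundamental_theorem_of_calculus_interior_strong[OF F] continuous_intros conts
        bounded_bilinear.has_vector_derivative[OF bounded_bilinear_inner u' \<zeta>']) auto
  \<comment> \<open>No boundary term survives, because \<open>B\<close> is orthogonal and maps both
    end values to the initial values.\<close>
  have "u L \<bullet> \<zeta> L = u 0 \<bullet> \<zeta> 0"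
    using orthogonal_matrix_inner[OF B, of "u L" "\<zeta> L"] by (simp add: Bu B\<zeta>)
  with 1 have 1: "((\<lambda>t. u t \<bullet> (R t *v u t - \<sigma> *\<^sub>R \<eta> t) + (\<zeta> t - \<sigma> *\<^sub>R w t) \<bullet> \<zeta> t) has_integral 0) {0..L}" by simp
  let ?h = "\<lambda>t. \<sigma> * (u t \<bullet> \<eta> t - w t \<bullet> \<zeta> t) + \<sigma>\<^sup>2 * (w t \<bullet> w t)"
  have "continuous_on {0..L} ?h" by (intro continuous_intros conts)
  then have int: "?h integrable_on {0..L}" by (rule integrable_continuous_real)
  have I: "((\<lambda>t. (\<zeta> t - \<sigma> *\<^sub>R w t) \<bullet> (\<zeta> t - \<sigma> *\<^sub>R w t) + (R t *v u t) \<bullet> u t) has_integral 0 + integral {0..L} ?h) {0..L}"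
    by (rule has_integral_eq[OF _ has_integral_add[OF 1 integrable_integral[OF int]]])
      (simp add: inner_diff_left inner_diff_right inner_commute power2_eq_square algebra_simps)
  have "0 \<le> 0 + integral {0..L} ?h"
    by (rule morse_index_zero_imp_nonneg[OF idx E F _ I]) (rule u')
  also have "0 + integral {0..L} ?h \<le> integral {0..L} (\<lambda>_. \<sigma> * ?W + \<sigma>\<^sup>2 * M\<^sup>2)"
    unfolding add_0
  proof (rule integral_le[OF int])
    fix t assume t: "t \<in> {0..L}"
    have "norm (w t) \<le> \<bar>sin (\<sigma> * t)\<bar> * norm (p t) + \<bar>cos (\<sigma> * t)\<bar> * norm (q t)"
      unfolding w_def by (rule norm_triangle_le) simp
    also have "\<dots> \<le> 1 * norm (p t) + 1 * norm (q t)"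
      by (intro add_mono mult_right_mono) auto
    also have "\<dots> \<le> M" using M[OF t] by simp
    finally have "w t \<bullet> w t \<le> M\<^sup>2"
      by (simp add: dot_square_norm power_mono)
    then show "?h t \<le> \<sigma> * ?W + \<sigma>\<^sup>2 * M\<^sup>2"
      unfolding W[OF t] by (simp add: mult_left_mono)
  qed (rule integrable_continuous_real, rule continuous_on_const)
  also have "\<dots> = L * (\<sigma> * ?W + \<sigma>\<^sup>2 * M\<^sup>2)"
    using \<open>L > 0\<close> by simp
  finally show ?thesis
    using \<open>L > 0\<close> by (simp add: zero_le_mult_iff)
qed

subsection \<open>Continuation to the iterates\<close>

declare transpose_matrix_vector [simp del]

text \<open>If \<open>p\<close>, \<open>q\<close> are the real and imaginary part of a solution whose value at \<open>0\<close> is multiplied by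
  \<open>cis \<theta>\<close> when going once around, then \<open>twisted_iterate T A \<theta> p q\<close> is the real part of its
  continuation, in the coordinates of the parallel frame along the iterate. The imaginary part is
  \<open>twisted_iterate T A \<theta> q (- p)\<close>.\<close>

definition twisted_iterate :: "real \<Rightarrow> real ^ 'n ^ 'n \<Rightarrow> real \<Rightarrow> (real \<Rightarrow> real ^ 'n) \<Rightarrow> (real \<Rightarrow> real ^ 'n::finite) \<Rightarrow>
    real \<Rightarrow> real ^ 'n" where
  "twisted_iterate T A \<theta> p q t = (let k = nat \<lfloor>t / T\<rfloor>; s = t - real k * T in
     transpose (matrix_pow A k) *v (cos (real k * \<theta>) *\<^sub>R p s - sin (real k * \<theta>) *\<^sub>R q s))"

text \<open>Real and imaginary part of one complex equation: \<open>A\<close> maps the value of p +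
  iq at \<open>T\<close> to \<open>cis \<theta>\<close> times its value at 0.\<close>

definition twisted_pair :: "real \<Rightarrow> real ^ 'n ^ 'n \<Rightarrow> real \<Rightarrow> (real \<Rightarrow> real ^ 'n) \<Rightarrow> (real \<Rightarrow> real ^ 'n::finite) \<Rightarrow> bool" where
  "twisted_pair T A \<theta> p q \<longleftrightarrow> A *v p T = cos \<theta> *\<^sub>R p 0 - sin \<theta> *\<^sub>R q 0 \<and> A *v q T = sin \<theta> *\<^sub>R p 0 + cos \<theta> *\<^sub>R q 0"

text \<open>Multiplication of p + iq by -i, which commutes with the twist.\<close>

lemma twisted_pair_rotate: "twisted_pair T A \<theta> p q \<Longrightarrow> twisted_pair T A \<theta> q (\<lambda>t. - p t)"
  by (simp add: twisted_pair_def linear_neg[OF matrix_vector_mul_linear])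

lemma twisted_iterate_at:
  assumes "T > 0"
  shows "twisted_iterate T A \<theta> p q (real k * T) =
    transpose (matrix_pow A k) *v (cos (real k * \<theta>) *\<^sub>R p 0 - sin (real k * \<theta>) *\<^sub>R q 0)"
  using assms by (simp add: twisted_iterate_def Let_def)

text \<open>At the right end point the floor function already selects the next piece. Both pieces
  agree there by the twist condition and the orthogonality of \<open>A\<close>, so the formula holds
  on the closed period.\<close>

lemma twisted_iterate_on:
  assumes "T > 0" and A: "orthogonal_matrix A" and tw: "twisted_pair T A \<theta> p q"
    and t: "t \<in> {real k * T .. real (Suc k) * T}"
  shows "twisted_iterate T A \<theta> p q t = transpose (matrix_pow A k) *v
    (cos (real k * \<theta>) *\<^sub>R p (t - real k * T) - sin (real k * \<theta>) *\<^sub>R q (t - real k * T))"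
proof (cases "t = real (Suc k) * T")
  case True
  have "A *v (cos (real k * \<theta>) *\<^sub>R p T - sin (real k * \<theta>) *\<^sub>R q T)
      = cos (real k * \<theta>) *\<^sub>R (cos \<theta> *\<^sub>R p 0 - sin \<theta> *\<^sub>R q 0) - sin (real k * \<theta>) *\<^sub>R (sin \<theta> *\<^sub>R p 0 + cos \<theta> *\<^sub>R q 0)"
    using tw by (simp add: twisted_pair_def matrix_vector_mult_diff_distrib matrix_vector_mult_scaleR)
  also have "\<dots> = cos (real k * \<theta> + \<theta>) *\<^sub>R p 0 - sin (real k * \<theta> + \<theta>) *\<^sub>R q 0"
    unfolding cos_add sin_add by (simp add: algebra_simps)
  finally have step: "cos (real (Suc k) * \<theta>) *\<^sub>R p 0 - sin (real (Suc k) * \<theta>) *\<^sub>R q 0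
      = A *v (cos (real k * \<theta>) *\<^sub>R p T - sin (real k * \<theta>) *\<^sub>R q T)"
    by (simp add: distrib_right add.commute)
  have tr: "transpose (matrix_pow A (Suc k)) ** A = transpose (matrix_pow A k)"
    using A by (simp add: matrix_pow_Suc matrix_transpose_mul matrix_mul_assoc[symmetric] orthogonal_matrix)
  have "t - real k * T = T" using True by (simp add: distrib_right)
  then show ?thesis
    unfolding True twisted_iterate_at[OF \<open>T > 0\<close>] step matrix_vector_mul_assoc tr
    by (simp add: distrib_right)
next
  case False
  then have "\<lfloor>t / T\<rfloor> = int k"
    using t \<open>T > 0\<close> by (intro floor_unique) (auto simp: field_simps)
  then show ?thesis by (simp add: twisted_iterate_def Let_def)
qed

lemma continuous_on_twisted_iterate:
  assumes "T > 0" "orthogonal_matrix A" "twisted_pair T A \<theta> p q"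
    and "continuous_on {0..T} p" "continuous_on {0..T} q"
  shows "continuous_on {0..real m * T} (twisted_iterate T A \<theta> p q)"
proof (induction m)
  case (Suc m)
  have c: "continuous_on {real m * T..real (Suc m) * T} (\<lambda>t. f (t - real m * T))"
    if "continuous_on {0..T} f" for f :: "real \<Rightarrow> real ^ 'n"
    by (rule continuous_on_compose2[OF that]) (auto intro!: continuous_intros simp: distrib_right)
  have "continuous_on {real m * T..real (Suc m) * T} (\<lambda>t. transpose (matrix_pow A m) *v
    (cos (real m * \<theta>) *\<^sub>R p (t - real m * T) - sin (real m * \<theta>) *\<^sub>R q (t - real m * T)))"
    by (intro linear_continuous_on_compose[OF _ matrix_vector_mul_linear] continuous_on_diff
        continuous_on_scaleR continuous_on_const c assms)
  then have "continuous_on {real m * T..real (Suc m) * T} (twisted_iterate T A \<theta> p q)"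
    by (subst continuous_on_cong[OF refl twisted_iterate_on[OF assms(1-3)]])
  then have "continuous_on ({0..real m * T} \<union> {real m * T..real (Suc m) * T}) (twisted_iterate T A \<theta> p q)"
    by (intro continuous_on_closed_Un Suc.IH) auto
  moreover have "{0..real m * T} \<union> {real m * T..real (Suc m) * T} = {0..real (Suc m) * T}"
    using \<open>T > 0\<close> by (intro ivl_disj_un_two_touch) (auto simp: distrib_right)
  ultimately show ?case by simp
qed simp

lemma has_vector_derivative_twisted_iterate:
  assumes "T > 0" "orthogonal_matrix A" "twisted_pair T A \<theta> p q"
    and t: "real k * T < t" "t < real (Suc k) * T"
    and p: "(p has_vector_derivative p') (at (t - real k * T))"
    and q: "(q has_vector_derivative q') (at (t - real k * T))"
  shows "(twisted_iterate T A \<theta> p q has_vector_derivative transpose (matrix_pow A k) *v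
    (cos (real k * \<theta>) *\<^sub>R p' - sin (real k * \<theta>) *\<^sub>R q')) (at t)"
proof -
  have s: "((\<lambda>t. f (t - real k * T)) has_vector_derivative f') (at t)"
    if "(f has_vector_derivative f') (at (t - real k * T))" for f :: "real \<Rightarrow> real ^ 'n" and f'
    by (rule has_vector_derivative_shift[of UNIV t UNIV _ UNIV, OF _ _ _ _ _ that]) auto
  have "((\<lambda>t. transpose (matrix_pow A k) *v (cos (real k * \<theta>) *\<^sub>R p (t - real k * T) - sin (real k * \<theta>) *\<^sub>R q (t - real k * T)))
      has_vector_derivative transpose (matrix_pow A k) *v (cos (real k * \<theta>) *\<^sub>R p' - sin (real k * \<theta>) *\<^sub>R q')) (at t)"
    by (intro bounded_linear.has_vector_derivative[OF matrix_vector_mul_bounded_linear]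
        has_vector_derivative_diff bounded_linear.has_vector_derivative[OF bounded_linear_scaleR_right] s p q)
  then show ?thesis
    by (rule has_vector_derivative_transform_within_open[of _ _ _ "{real k * T<..<real (Suc k) * T}"])
      (use t in \<open>auto simp: twisted_iterate_on[OF assms(1-3), of _ k]\<close>)
qed

text \<open>The bound is the same for all periods, since powers of \<open>A\<close> are isometries
  and the rotation coefficients are at most 1 in absolute value.\<close>

lemma norm_twisted_iterate_le:
  assumes "T > 0" "orthogonal_matrix A"
    and p: "\<And>s. s \<in> {0..T} \<Longrightarrow> norm (p s) \<le> K" and q: "\<And>s. s \<in> {0..T} \<Longrightarrow> norm (q s) \<le> K"
    and "t \<ge> 0"
  shows "norm (twisted_iterate T A \<theta> p q t) \<le> 2 * K"
proof -
  define k where "k = nat \<lfloor>t / T\<rfloor>"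
  define s where "s = t - real k * T"
  have "real k = of_int \<lfloor>t / T\<rfloor>" using assms(1,5) by (simp add: k_def)
  then have "real k \<le> t / T" "t / T < real k + 1" by linarith+
  then have s: "s \<in> {0..T}" using \<open>T > 0\<close> by (auto simp: s_def field_simps)
  have "orthogonal_matrix (transpose (matrix_pow A k))"
    using orthogonal_matrix_pow[OF assms(2)] by (simp add: orthogonal_matrix_transpose)
  then have "norm (twisted_iterate T A \<theta> p q t) = norm (cos (real k * \<theta>) *\<^sub>R p s - sin (real k * \<theta>) *\<^sub>R q s)"
    by (simp add: twisted_iterate_def Let_def k_def[symmetric] s_def norm_eq_sqrt_inner orthogonal_matrix_inner)
  also have "\<dots> \<le> \<bar>cos (real k * \<theta>)\<bar> * norm (p s) + \<bar>sin (real k * \<theta>)\<bar> * norm (q s)"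
    by (rule norm_triangle_le_diff) simp
  also have "\<dots> \<le> 1 * K + 1 * K"
    using p[OF s] q[OF s] by (intro add_mono mult_mono) (auto intro: order_trans[OF norm_ge_zero])
  finally show ?thesis by simp
qed

lemma matrix_pow_twisted_iterate:
  assumes "T > 0" "orthogonal_matrix A"
  shows "matrix_pow A m *v twisted_iterate T A \<theta> p q (real m * T) =
     cos (real m * \<theta>) *\<^sub>R p 0 - sin (real m * \<theta>) *\<^sub>R q 0"
  using orthogonal_matrix_pow[OF assms(2), of m]
  by (simp add: twisted_iterate_at[OF assms(1)] matrix_vector_mul_assoc orthogonal_matrix_def)

lemma twisted_iterate_0 [simp]: "twisted_iterate T A \<theta> p q 0 = p 0"
  by (simp add: twisted_iterate_def transpose_mat)

text \<open>The quadratic in \<sigma> is negative strictly between 0 and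
  \<open>- W / M\<^sup>2\<close>. Rational multiples of 2 pi are dense, so some \<sigma> in this
  interval makes \<open>\<sigma> * T + \<theta>\<close> one of them; its denominator is the iterate
  \<open>m\<close>.\<close>

lemma small_rotation_exists:
  fixes W M T \<theta> :: real
  assumes "W \<noteq> 0" "M > 0" "T > 0"
  obtains \<sigma> m l where "m \<ge> 1" "\<sigma> * (real m * T) + real m * \<theta> = 2 * pi * of_int l"
    "\<sigma> * W + \<sigma>\<^sup>2 * M\<^sup>2 < 0"
proof -
  define a where "a = (if W > 0 then - W / M\<^sup>2 else 0)"
  define b where "b = (if W > 0 then 0 else - W / M\<^sup>2)"
  have "a < b" using assms by (auto simp: a_def b_def field_simps)
  then have "(T * a + \<theta>) / (2 * pi) < (T * b + \<theta>) / (2 * pi)"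
    using \<open>T > 0\<close> by (intro divide_strict_right_mono) auto
  then obtain r where "r \<in> \<rat>" and r: "(T * a + \<theta>) / (2 * pi) < r" "r < (T * b + \<theta>) / (2 * pi)"
    using Rats_dense_in_real by blast
  obtain l n where ln: "n > 0" "r = of_int l / of_int n"
    using \<open>r \<in> \<rat>\<close> by (auto elim: Rats_cases')
  define \<sigma> where "\<sigma> = (2 * pi * r - \<theta>) / T"
  have \<sigma>: "a < \<sigma>" "\<sigma> < b"
    using r \<open>T > 0\<close> by (auto simp: \<sigma>_def field_simps)
  have "\<sigma> * (W + \<sigma> * M\<^sup>2) < 0"
  proof (cases "W > 0")
    case True
    then have "\<sigma> < 0" "W + \<sigma> * M\<^sup>2 > 0" using \<sigma> \<open>M > 0\<close> by (auto simp: a_def b_def field_simps)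
    then show ?thesis by (rule mult_neg_pos)
  next
    case False
    then have "\<sigma> > 0" "W + \<sigma> * M\<^sup>2 < 0" using \<sigma> \<open>M > 0\<close> by (auto simp: a_def b_def field_simps)
    then show ?thesis by (rule mult_pos_neg)
  qed
  then have 1: "\<sigma> * W + \<sigma>\<^sup>2 * M\<^sup>2 < 0" by (simp add: power2_eq_square algebra_simps)
  have "\<sigma> * (real (nat n) * T) + real (nat n) * \<theta> = real (nat n) * (2 * pi * r)"
    using \<open>T > 0\<close> by (simp add: \<sigma>_def field_simps)
  also have "\<dots> = 2 * pi * of_int l" using ln by simp
  finally show thesis using 1 ln by (intro that[of "nat n" \<sigma> l]) auto
qed

lemma twisted_solutions_wronskian_zero:
  fixes p q y z :: "real \<Rightarrow> real ^ 'n::finite" and R :: "real \<Rightarrow> real ^ 'n ^ 'n"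
  assumes "T > 0" and A: "orthogonal_matrix A"
    and cont: "continuous_on {0..T} p" "continuous_on {0..T} q"
      "continuous_on {0..T} y" "continuous_on {0..T} z"
    and p: "\<And>t. t \<in> {0<..<T} \<Longrightarrow> (p has_vector_derivative y t) (at t)"
    and q: "\<And>t. t \<in> {0<..<T} \<Longrightarrow> (q has_vector_derivative z t) (at t)"
    and y: "\<And>t. t \<in> {0<..<T} \<Longrightarrow> (y has_vector_derivative R t *v p t) (at t)"
    and z: "\<And>t. t \<in> {0<..<T} \<Longrightarrow> (z has_vector_derivative R t *v q t) (at t)"
    and R: "\<And>t. t \<in> {0<..<T} \<Longrightarrow> transpose (R t) = R t"
    and tw: "twisted_pair T A \<theta> p q" "twisted_pair T A \<theta> y z"
    and Rm: "\<And>m k t. k < m \<Longrightarrow> real k * T < t \<Longrightarrow> t < real (Suc k) * T \<Longrightarrow>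
        Rm m t = transpose (matrix_pow A k) ** R (t - real k * T) ** matrix_pow A k"
    and idx: "\<And>m. m \<ge> 1 \<Longrightarrow> morse_index (real m * T) (matrix_pow A m) (Rm m) = 0"
  shows "p 0 \<bullet> z 0 - q 0 \<bullet> y 0 = 0"
proof (rule ccontr)
  assume W: "p 0 \<bullet> z 0 - q 0 \<bullet> y 0 \<noteq> 0"
  have "bounded (p ` {0..T} \<union> q ` {0..T})"
    using cont by (intro bounded_Un[THEN iffD2] conjI compact_imp_bounded compact_continuous_image) auto
  then obtain K where K: "K > 0" "\<And>v. v \<in> p ` {0..T} \<union> q ` {0..T} \<Longrightarrow> norm v \<le> K"
    by (meson bounded_pos)
  then have Kp: "norm (p s) \<le> K" "norm (q s) \<le> K" if "s \<in> {0..T}" for s using that by blast+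
  \<comment> \<open>Real and imaginary part of the continuation are each bounded by
    \<open>2 * K\<close>, whence \<open>4 * K\<close>. This bound is fixed before \<open>m\<close>
    is known.\<close>
  obtain \<sigma> m l where m: "m \<ge> 1" and \<sigma>: "\<sigma> * (real m * T) + real m * \<theta> = 2 * pi * of_int l"
    and neg: "\<sigma> * (p 0 \<bullet> z 0 - q 0 \<bullet> y 0) + \<sigma>\<^sup>2 * (4 * K)\<^sup>2 < 0"
    using small_rotation_exists[OF W mult_pos_pos[OF zero_less_numeral \<open>K > 0\<close>] \<open>T > 0\<close>] by metis
  let ?it = "twisted_iterate T A \<theta>"
  let ?P = "?it p q" and ?Q = "?it q (\<lambda>t. - p t)" and ?Y = "?it y z" and ?Z = "?it z (\<lambda>t. - y t)"
  note twr = twisted_pair_rotate[OF tw(1)] twisted_pair_rotate[OF tw(2)]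
  have mneg: "M *v - x = - (M *v x)" for M :: "real ^ 'n ^ 'n" and x
    by (rule linear_neg[OF matrix_vector_mul_linear])
  \<comment> \<open>The times at which consecutive periods are glued, where differentiability of the
    continuation is not claimed.\<close>
  define F where "F = (\<lambda>k. real k * T) ` {..m}"
  have piece: "\<exists>k<m. real k * T < t \<and> t < real (Suc k) * T \<and> t - real k * T \<in> {0<..<T}"
    if t: "t \<in> {0<..<real m * T} - F" for t
  proof -
    define k where "k = nat \<lfloor>t / T\<rfloor>"
    have rk: "real k = of_int \<lfloor>t / T\<rfloor>" using t \<open>T > 0\<close> by (simp add: k_def)
    have "real k \<le> t / T" "t / T < real (Suc k)" using rk by linarith+
    then have *: "real k * T \<le> t" "t < real (Suc k) * T" using \<open>T > 0\<close> by (auto simp: field_simps)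
    have "real k * T < real m * T" using *(1) t by auto
    then have "k < m" using \<open>T > 0\<close> by simp
    then have "t \<noteq> real k * T" using t by (auto simp: F_def)
    with * \<open>k < m\<close> show ?thesis by (auto simp: distrib_right)
  qed
  have AA: "matrix_pow A k *v (transpose (matrix_pow A k) *v v) = v" for k v
    using orthogonal_matrix_pow[OF A, of k] by (simp add: matrix_vector_mul_assoc orthogonal_matrix_def)
  have "0 \<le> \<sigma> * (?P 0 \<bullet> ?Z 0 - ?Q 0 \<bullet> ?Y 0) + \<sigma>\<^sup>2 * (4 * K)\<^sup>2"
  proof (rule twisted_solutions_index_form[where F = F and L = "real m * T" and R = "Rm m" and B = "matrix_pow A m"
        and \<alpha> = "real m * \<theta>" and p = ?P and q = ?Q and y = ?Y and z = ?Z])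
    show "0 < real m * T" using m \<open>T > 0\<close> by simp
    show "finite F" by (simp add: F_def)
    show "continuous_on {0..real m * T} ?P" "continuous_on {0..real m * T} ?Q"
      "continuous_on {0..real m * T} ?Y" "continuous_on {0..real m * T} ?Z"
      by (intro continuous_on_twisted_iterate \<open>T > 0\<close> A tw twr cont continuous_on_minus)+
    show "orthogonal_matrix (matrix_pow A m)" by (rule orthogonal_matrix_pow[OF A])
    show "morse_index (real m * T) (matrix_pow A m) (Rm m) = 0" by (rule idx[OF m])
    show "sin (\<sigma> * (real m * T) + real m * \<theta>) = 0" "cos (\<sigma> * (real m * T) + real m * \<theta>) = 1"
      unfolding \<sigma> by (simp_all add: sin_int_2pin cos_int_2pin)
    show "matrix_pow A m *v ?P (real m * T) = cos (real m * \<theta>) *\<^sub>R ?P 0 - sin (real m * \<theta>) *\<^sub>R ?Q 0"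
      "matrix_pow A m *v ?Q (real m * T) = sin (real m * \<theta>) *\<^sub>R ?P 0 + cos (real m * \<theta>) *\<^sub>R ?Q 0"
      "matrix_pow A m *v ?Y (real m * T) = cos (real m * \<theta>) *\<^sub>R ?Y 0 - sin (real m * \<theta>) *\<^sub>R ?Z 0"
      "matrix_pow A m *v ?Z (real m * T) = sin (real m * \<theta>) *\<^sub>R ?Y 0 + cos (real m * \<theta>) *\<^sub>R ?Z 0"
      by (simp_all add: matrix_pow_twisted_iterate[OF \<open>T > 0\<close> A])
    show "norm (?P t) + norm (?Q t) \<le> 4 * K" if "t \<in> {0..real m * T}" for t
      using norm_twisted_iterate_le[OF \<open>T > 0\<close> A, of p K q t \<theta>]
        norm_twisted_iterate_le[OF \<open>T > 0\<close> A, of q K "\<lambda>t. - p t" t \<theta>] Kp that by fastforce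
    fix t assume t: "t \<in> {0<..<real m * T} - F"
    obtain k where k: "k < m" "real k * T < t" "t < real (Suc k) * T" and s: "t - real k * T \<in> {0<..<T}"
      using piece[OF t] by blast
    have tc: "t \<in> {real k * T .. real (Suc k) * T}" using k by auto
    note on = twisted_iterate_on[OF \<open>T > 0\<close> A _ tc]
    note dv = has_vector_derivative_twisted_iterate[OF \<open>T > 0\<close> A _ k(2,3)]
    note Rt = Rm[OF k]
    show "transpose (Rm m t) = Rm m t"
      by (simp add: Rt matrix_transpose_mul R[OF s] matrix_mul_assoc)
    show "(?P has_vector_derivative ?Y t) (at t)"
      using dv[OF tw(1) p[OF s] q[OF s]] by (simp add: on[OF tw(2)])
    show "(?Q has_vector_derivative ?Z t) (at t)"
      using dv[OF twr(1) q[OF s] has_vector_derivative_minus[OF p[OF s]]] by (simp add: on[OF twr(2)])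
    show "(?Y has_vector_derivative Rm m t *v ?P t) (at t)"
      using dv[OF tw(2) y[OF s] z[OF s]]
      by (simp add: on[OF tw(1)] Rt matrix_vector_mul_assoc[symmetric] AA matrix_vector_mult_diff_distrib matrix_vector_mult_scaleR)
    show "(?Z has_vector_derivative Rm m t *v ?Q t) (at t)"
      using dv[OF twr(2) z[OF s] has_vector_derivative_minus[OF y[OF s]]]
      by (simp add: on[OF twr(1)] Rt matrix_vector_mul_assoc[symmetric] AA matrix_vector_right_distrib matrix_vector_mult_scaleR mneg)
  qed
  with neg show False by simp
qed

subsection \<open>The monodromy matrix\<close>

lemma fundamental_solution_derivatives:
  assumes "fundamental_solution T R \<Psi>" "t \<in> {0..T}"
  shows "((\<lambda>t. upper (\<Psi> t *v v)) has_vector_derivative R t *v lower (\<Psi> t *v v)) (at t within {0..T})"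
    and "((\<lambda>t. lower (\<Psi> t *v v)) has_vector_derivative upper (\<Psi> t *v v)) (at t within {0..T})"
proof -
  have mv: "bounded_linear (\<lambda>M. M *v v)"
    by (intro linear_conv_bounded_linear[THEN iffD1] linearI)
      (simp_all add: matrix_vector_mult_add_rdistrib scaleR_matrix_vector_assoc)
  have "(\<Psi> has_vector_derivative block_matrix 0 (R t) (mat 1) 0 ** \<Psi> t) (at t within {0..T})"
    using assms by (simp add: fundamental_solution_def)
  from bounded_linear.has_vector_derivative[OF mv this]
  have D: "((\<lambda>t. \<Psi> t *v v) has_vector_derivative block_matrix 0 (R t) (mat 1) 0 *v (\<Psi> t *v v)) (at t within {0..T})"
    by (simp add: matrix_vector_mul_assoc)
  show "((\<lambda>t. upper (\<Psi> t *v v)) has_vector_derivative R t *v lower (\<Psi> t *v v)) (at t within {0..T})"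
    using bounded_linear.has_vector_derivative[OF upper_lower_linear(1) D]
    by (simp add: upper_lower_block_matrix)
  show "((\<lambda>t. lower (\<Psi> t *v v)) has_vector_derivative upper (\<Psi> t *v v)) (at t within {0..T})"
    using bounded_linear.has_vector_derivative[OF upper_lower_linear(2) D]
    by (simp add: upper_lower_block_matrix)
qed

text \<open>The derivative of the symplectic form along two solutions vanishes because
  \<open>R t\<close> is symmetric.\<close>

lemma omega_fundamental_solution:
  assumes sol: "fundamental_solution T R \<Psi>" and "T > 0"
    and R: "\<And>t. t \<in> {0..T} \<Longrightarrow> transpose (R t) = R t"
  shows "omega (\<Psi> T *v v) (\<Psi> T *v w) = omega v w"
proof -
  note D = fundamental_solution_derivatives[OF sol]
  have "((\<lambda>t. 0) has_integral omega (\<Psi> T *v v) (\<Psi> T *v w) - omega (\<Psi> 0 *v v) (\<Psi> 0 *v w)) {0..T}"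
  proof (rule fundamental_theorem_of_calculus)
    fix t assume t: "t \<in> {0..T}"
    show "((\<lambda>t. omega (\<Psi> t *v v) (\<Psi> t *v w)) has_vector_derivative 0) (at t within {0..T})"
      unfolding omega_eq
      by (rule has_vector_derivative_eq_rhs[OF has_vector_derivative_diff[OF
            bounded_bilinear.has_vector_derivative[OF bounded_bilinear_inner D(2)[OF t] D(1)[OF t]]
            bounded_bilinear.has_vector_derivative[OF bounded_bilinear_inner D(2)[OF t] D(1)[OF t]]]])
        (simp add: symmetric_matrix_inner[OF R[OF t], of "lower (\<Psi> t *v v)"] inner_commute)
  qed (use \<open>T > 0\<close> in simp)
  then show ?thesis
    using sol by (simp add: has_integral_0_eq fundamental_solution_def)
qed

lemma matrix_inv_transpose_orthogonal:
  assumes "orthogonal_matrix (A :: real ^ 'n ^ 'n)"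
  shows "matrix_inv (transpose A) = A"
proof -
  have A: "transpose A ** A = mat 1" "A ** transpose A = mat 1"
    using assms by (simp_all add: orthogonal_matrix_def)
  then have "transpose A ** matrix_inv (transpose A) = mat 1"
    using matrix_inv_inverse[of "transpose A"] by (auto simp: invertible_def)
  then have "A ** (transpose A ** matrix_inv (transpose A)) = A" by simp
  then show ?thesis by (simp add: matrix_mul_assoc A)
qed

lemma upper_lower_monodromy:
  assumes "orthogonal_matrix A"
  shows "upper (monodromy_matrix A M *v v) = A *v upper (M *v v)"
    "lower (monodromy_matrix A M *v v) = A *v lower (M *v v)"
  by (simp_all add: monodromy_matrix_def matrix_inv_transpose_orthogonal[OF assms]
      matrix_vector_mul_assoc[symmetric] upper_lower_block_matrix)

text \<open>For orthogonal \<open>A\<close> the block matrix in front of \<open>\<Psi> T\<close>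
  acts as \<open>A\<close> on both halves and so preserves \<open>omega\<close>.\<close>

lemma symplectic_monodromy:
  assumes "fundamental_solution T R \<Psi>" "T > 0" "\<And>t. t \<in> {0..T} \<Longrightarrow> transpose (R t) = R t"
    and A: "orthogonal_matrix A"
  shows "symplectic (monodromy_matrix A (\<Psi> T))"
  unfolding symplectic_iff_omega
proof (intro allI)
  fix v w
  have 1: "omega (monodromy_matrix A (\<Psi> T) *v v) (monodromy_matrix A (\<Psi> T) *v w) = omega (\<Psi> T *v v) (\<Psi> T *v w)"
    by (simp add: omega_eq upper_lower_monodromy[OF A] orthogonal_matrix_inner[OF A])
  show "omega (monodromy_matrix A (\<Psi> T) *v v) (monodromy_matrix A (\<Psi> T) *v w) = omega v w"
    unfolding 1 by (rule omega_fundamental_solution[OF assms(1-3)])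
qed

lemma monodromy_eigenvector_isotropic:
  fixes A :: "real ^ 'n ^ 'n::finite"
  assumes sol: "fundamental_solution T R \<Psi>" and "T > 0"
    and R: "\<And>t. t \<in> {0..T} \<Longrightarrow> transpose (R t) = R t"
    and A: "orthogonal_matrix A"
    and Rm: "\<And>m k t. k < m \<Longrightarrow> real k * T < t \<Longrightarrow> t < real (Suc k) * T \<Longrightarrow>
        Rm m t = transpose (matrix_pow A k) ** R (t - real k * T) ** matrix_pow A k"
    and idx: "\<And>m. m \<ge> 1 \<Longrightarrow> morse_index (real m * T) (matrix_pow A m) (Rm m) = 0"
    and \<mu>: "cmod \<mu> = 1" and eig: "map_matrix complex_of_real (monodromy_matrix A (\<Psi> T)) *v \<zeta> = \<mu> *s \<zeta>"
  shows "krein \<zeta> \<zeta> = 0"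
proof -
  let ?P = "monodromy_matrix A (\<Psi> T)" and ?a = "re_vec \<zeta>" and ?b = "im_vec \<zeta>"
  obtain \<theta> where \<theta>: "\<mu> = cis \<theta>"
    using \<mu> by (metis cis_Arg norm_zero sgn_eq div_by_1 of_real_1 zero_neq_one)
  have P: "?P *v ?a = cos \<theta> *\<^sub>R ?a - sin \<theta> *\<^sub>R ?b" "?P *v ?b = sin \<theta> *\<^sub>R ?a + cos \<theta> *\<^sub>R ?b"
    unfolding re_im_vec_matrix[symmetric] eig re_im_vec_mult \<theta> by simp_all
  have \<Psi>0: "\<Psi> 0 *v v = v" for v using sol by (simp add: fundamental_solution_def)
  have u: "upper (x - y) = upper x - upper y" "upper (x + y) = upper x + upper y" "upper (r *\<^sub>R x) = r *\<^sub>R upper x"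
    and l: "lower (x - y) = lower x - lower y" "lower (x + y) = lower x + lower y" "lower (r *\<^sub>R x) = r *\<^sub>R lower x"
    for x y :: "real ^ ('n + 'n)" and r
    by (simp_all add: upper_def lower_def vec_eq_iff)
  note D = fundamental_solution_derivatives[OF sol]
  have at: "at t within {0..T} = at t" if "t \<in> {0<..<T}" for t
    using that by (intro at_within_interior) simp
  have Di: "((\<lambda>t. upper (\<Psi> t *v v)) has_vector_derivative R t *v lower (\<Psi> t *v v)) (at t)"
    "((\<lambda>t. lower (\<Psi> t *v v)) has_vector_derivative upper (\<Psi> t *v v)) (at t)"
    if "t \<in> {0<..<T}" for t v
    using D[of t v] that by (simp_all add: at[OF that])
  have cont: "continuous_on {0..T} (\<lambda>t. upper (\<Psi> t *v v))" "continuous_on {0..T} (\<lambda>t. lower (\<Psi> t *v v))" for v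
    unfolding continuous_on_eq_continuous_within
    by (blast intro: has_vector_derivative_continuous D)+
  \<comment> \<open>The lower and the upper half of the eigenvector equation for
    \<open>cis \<theta>\<close> are exactly the twist conditions for the solution and for its
    derivative.\<close>
  have tw: "twisted_pair T A \<theta> (\<lambda>t. lower (\<Psi> t *v ?a)) (\<lambda>t. lower (\<Psi> t *v ?b))"
    "twisted_pair T A \<theta> (\<lambda>t. upper (\<Psi> t *v ?a)) (\<lambda>t. upper (\<Psi> t *v ?b))"
    unfolding twisted_pair_def upper_lower_monodromy[OF A, symmetric] \<Psi>0 P u l by simp_all
  have "lower (\<Psi> 0 *v ?a) \<bullet> upper (\<Psi> 0 *v ?b) - lower (\<Psi> 0 *v ?b) \<bullet> upper (\<Psi> 0 *v ?a) = 0"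
    by (rule twisted_solutions_wronskian_zero[OF \<open>T > 0\<close> A cont(2) cont(2) cont(1) cont(1) _ _ _ _ _ tw Rm idx])
      (auto intro: Di R)
  then show ?thesis
    unfolding krein_self_eq_0 omega_eq \<Psi>0 .
qed

theorem theorem4:
  fixes X :: "'m topology"
    and \<A> :: "('m, 'd::finite) chart set"
    and g :: "('m, 'd) metric"
    and T :: real
    and \<gamma> :: "real \<Rightarrow> 'm"
    and e :: "'n::finite \<Rightarrow> real \<Rightarrow> ('m, 'd) tvec"
    and A :: "real ^ 'n ^ 'n"
    and \<Psi> :: "real \<Rightarrow> real ^ ('n + 'n) ^ ('n + 'n)"
  assumes dim: "CARD('d) = CARD('n) + 1"
    and geodesic: "closed_geodesic X \<A> g T \<gamma>"
    and signature: "riemannian_manifold X \<A> g \<and> (\<exists>t\<in>{0..T}. \<gamma> t \<noteq> \<gamma> 0) \<or>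
                    lorentzian_manifold X \<A> g \<and> timelike \<A> g T \<gamma>"
    and frame: "normal_parallel_frame \<A> g T \<gamma> e"
    and holonomy: "holonomy_matrix \<A> T \<gamma> e A"
    and index: "\<forall>m\<ge>1. geodesic_morse_index \<A> g (real m * T) (iterate_curve T \<gamma>)
                        (iterate_frame T A e) (matrix_pow A m) = 0"
    and fundamental: "fundamental_solution T (curvature_matrix \<A> g T \<gamma> e) \<Psi>"
  shows "\<not> strongly_stable (monodromy_matrix A (\<Psi> T))"
proof
  assume strong: "strongly_stable (monodromy_matrix A (\<Psi> T))"
  interpret pseudo_riemannian_manifold X \<A> g
    using signature
    by unfold_locales (auto simp: riemannian_manifold_def lorentzian_manifold_def
        intro: positive_definite_invertible lorentz_signature_invertible)
  have T: "T > 0" and closed: "\<gamma> 0 = \<gamma> T" and cm: "continuous_map (top_of_set {0..T}) X \<gamma>"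
    using geodesic by (auto simp: closed_geodesic_def smooth_curve_def)
  have top: "\<gamma> t \<in> topspace X" if "t \<in> {0..T}" for t
    using cm that by (auto simp: continuous_map_def)
  have A: "orthogonal_matrix A"
    by (rule orthogonal_holonomy[OF T closed _ frame holonomy]) (use top T in simp)
  let ?R = "curvature_matrix \<A> g T \<gamma> e"
  have R: "transpose (?R t) = ?R t" if "t \<in> {0..T}" for t
    by (rule transpose_curvature_matrix[of \<gamma>, OF top[OF that]])
  have symp: "symplectic (monodromy_matrix A (\<Psi> T))"
    by (rule symplectic_monodromy[OF fundamental T R A])
  have "\<not> linearly_stable (monodromy_matrix A (\<Psi> T))"
  proof (rule not_linearly_stable_if_isotropic_eigenvectors[OF symp])
    fix \<mu> \<zeta>
    assume \<mu>: "cmod \<mu> = 1" and eig: "map_matrix complex_of_real (monodromy_matrix A (\<Psi> T)) *v \<zeta> = \<mu> *s \<zeta>"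
    show "krein \<zeta> \<zeta> = 0"
    proof (rule monodromy_eigenvector_isotropic[OF fundamental T R A _ _ \<mu> eig])
      fix m k t assume k: "k < m" "real k * T < t" "t < real (Suc k) * T"
      show "curvature_matrix \<A> g (real m * T) (iterate_curve T \<gamma>) (iterate_frame T A e) t =
        transpose (matrix_pow A k) ** ?R (t - real k * T) ** matrix_pow A k"
        by (rule curvature_matrix_iterate[OF T k top]) (use k in \<open>simp add: distrib_right\<close>)
    next
      fix m :: nat assume "1 \<le> m"
      then show "morse_index (real m * T) (matrix_pow A m)
          (curvature_matrix \<A> g (real m * T) (iterate_curve T \<gamma>) (iterate_frame T A e)) = 0"
        using index by (simp add: geodesic_morse_index_def)
    qed
  qed
  \<comment> \<open>Strong stability is applied to the unperturbed matrix, which is symplectic and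
    at distance 0 from itself.\<close>
  moreover have "linearly_stable (monodromy_matrix A (\<Psi> T))"
    using strong symp unfolding strongly_stable_def by force
  ultimately show False by contradiction
qed

end
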